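(* (Relations for $\mathcal K^1_{n,m}$.) Let $\mathcal L$ be a positive definite linear functional on $\prod^{N,M}$. For $0<n\le N$, $0<m\le M$, $$\Gamma_{n,m-1}\mathcal K^1_{n,m}=\mathcal K^1_{n,m-1}(\tilde A_{n-1,m}^{-1})^T-\mathcal K_{n,m-1}\hat{\tilde E}_{n-1,m}(\tilde A_{n-1,m}^{-1})^T,$$ $$\mathcal K^1_{n,m}(\tilde\Gamma_{n-1,m})^T=A_{n,m-1}^{-1}\mathcal K^1_{n-1,m}-A_{n,m-1}^{-1}\hat E_{n,m-1}\overline{\mathcal K_{n-1,m}}.$$
   Context: $\prod^{N,M}=\mathrm{span}\{z^iw^j:|i|\le N,|j|\le M\}$, $\hat\prod^{N,M}=\mathrm{span}\{z^iw^j:0\le i\le N,0\le j\le M\}$. For a (matrix valued) Laurent polynomial $Q$, $Q^\dagger(z,w)=Q(1/\bar z,1/\bar w)^\dagger$. A linear functional $\mathcal L$ on $\prod^{N,M}$ with $\mathcal L(z^{-i}w^{-j})=\overline{\mathcal L(z^iw^j)}$ is positive definite if $\mathcal L(pp^\dagger)>0$ for all nonzero $p\in\hat\prod^{N,M}$. It is applied entrywise and, for column vectors, $\langle X,Y\rangle=\mathcal L(XY^\dagger)$. Bars on matrices are entrywise conjugates. For $0\le l\le m$, $\phi^l_{n,m}$ is the unique element of $\mathrm{span}(\{z^iw^j:0\le i<n,0\le j\le m\}\cup\{z^nw^j:0\le j\le l\})$ with positive coefficient of $z^nw^l$, $\langle\phi^l_{n,m},\phi^l_{n,m}\rangle=1$,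 orthogonal to all of these monomials except $z^nw^l$; $\Phi_{n,m}=[\phi^m_{n,m},\dots,\phi^0_{n,m}]^T$. For $0\le l\le n$, $\tilde\phi^l_{n,m}$ is the unique element of $\mathrm{span}(\{z^iw^j:0\le i\le n,0\le j<m\}\cup\{z^iw^m:0\le i\le l\})$ with positive coefficient of $z^lw^m$, norm one, orthogonal to all of these monomials except $z^lw^m$; $\tilde\Phi_{n,m}=[\tilde\phi^n_{n,m},\dots,\tilde\phi^0_{n,m}]^T$. Reversals are the row vectors $\overleftarrow\Phi_{n,m}(z,w)=z^nw^m\Phi_{n,m}(1/\bar z,1/\bar w)^\dagger$, $\overleftarrow{\tilde\Phi}_{n,m}(z,w)=z^nw^m\tilde\Phi_{n,m}(1/\bar z,1/\bar w)^\dagger$. $\Phi_{n,-1}$ and $\tilde\Phi_{-1,m}$ are empty; matrices with zero rows or columns are empty. Coefficients: $\hat E_{n,m}=\langle z\Phi_{n-1,m},\overleftarrow\Phi_{n-1,m}^T\rangle$, $A_{n,m}=\langle z\Phi_{n-1,m},\Phi_{n,m}\rangle$ ($n\ge1$; $A_{n,m}$ is invertible), $\hat{\tilde E}_{n,m}=\langle w\tilde\Phi_{n,m-1},\overleftarrow{\tilde\Phi}_{n,m-1}^T\rangle$, $\tilde A_{n,m}=\langle w\tilde\Phi_{n,m-1},\tilde\Phi_{n,m}\rangle$ ($m\ge1$; $\tilde A_{n,m}$ is invertible), $\mathcal K_{n,m}=\langle\Phi_{n,m-1},\tilde\Phi_{n-1,m}\rangle$, $\mathcal K^1_{n,m}=\langle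 w\Phi_{n,m-1},\overleftarrow{\tilde\Phi}_{n-1,m}^T\rangle$, $\Gamma_{n,m}=\langle\Phi_{n,m-1},\Phi_{n,m}\rangle$, $\tilde\Gamma_{n,m}=\langle\tilde\Phi_{n-1,m},\tilde\Phi_{n,m}\rangle$. *)

theory Defs
  imports
    Complex_Main
    "HOL-Library.Poly_Mapping"
    "HOL-Library.Product_Plus"
    "HOL-Library.Complex_Order"
    "Jordan_Normal_Form.Gauss_Jordan_Elimination"
begin

section \<open>Laurent polynomials in two variables\<close>

text \<open>
  A Laurent polynomial in \<open>z\<close> and \<open>w\<close> is a finitely supported family of complex coefficients indexed
  by exponents \<open>(i, j)\<close>; multiplication on the type is convolution.
\<close>

type_synonym laurent = "(int \<times> int) \<Rightarrow>\<^sub>0 complex"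

definition monom_zw :: "int \<Rightarrow> int \<Rightarrow> laurent" where
  "monom_zw i j = Poly_Mapping.single (i, j) 1"

abbreviation coeff_zw :: "laurent \<Rightarrow> int \<Rightarrow> int \<Rightarrow> complex" where
  "coeff_zw p i j \<equiv> Poly_Mapping.lookup p (i, j)"

definition scale_zw :: "complex \<Rightarrow> laurent \<Rightarrow> laurent" where
  "scale_zw c p = Poly_Mapping.single 0 c * p"

interpretation laurent: vector_space scale_zw
  by unfold_locales
     (simp_all add: scale_zw_def distrib_left distrib_right single_add mult_single
        flip: mult.assoc)

definition Pi_space :: "int \<Rightarrow> int \<Rightarrow> laurent set" where
  "Pi_space N M = laurent.span {monom_zw i j | i j. \<bar>i\<bar> \<le> N \<and> \<bar>j\<bar> \<le> M}"

definition Pi_hat :: "int \<Rightarrow> int \<Rightarrow> laurent set" where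
  "Pi_hat N M = laurent.span {monom_zw i j | i j. 0 \<le> i \<and> i \<le> N \<and> 0 \<le> j \<and> j \<le> M}"

text \<open>
  The conjugate of \<open>p(1/cnj z, 1/cnj w)\<close> is obtained from \<open>p\<close> by conjugating all coefficients and
  negating all exponents.
\<close>

definition dagger :: "laurent \<Rightarrow> laurent" where
  "dagger p = Poly_Mapping.map_key uminus (Poly_Mapping.map cnj p)"

lemma coeff_dagger: "coeff_zw (dagger p) i j = cnj (coeff_zw p (- i) (- j))"
  by (simp add: dagger_def map_key.rep_eq map.rep_eq when_def)

definition mat_dagger :: "laurent mat \<Rightarrow> laurent mat" where
  "mat_dagger Q = map_mat dagger (transpose_mat Q)"


section \<open>Positive definite functionals\<close>

text \<open>
  A functional on the finite-dimensional space \<open>Pi_space N M\<close> is represented by a total function;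
  its values outside that space are unconstrained.
\<close>

definition linear_functional :: "int \<Rightarrow> int \<Rightarrow> (laurent \<Rightarrow> complex) \<Rightarrow> bool" where
  "linear_functional N M L \<longleftrightarrow>
     (\<forall>p\<in>Pi_space N M. \<forall>q\<in>Pi_space N M. L (p + q) = L p + L q) \<and>
     (\<forall>c. \<forall>p\<in>Pi_space N M. L (scale_zw c p) = c * L p)"

text \<open>The order on the complex numbers is such that \<open>0 < x\<close> means that \<open>x\<close> is real and positive.\<close>

definition pos_def_functional :: "int \<Rightarrow> int \<Rightarrow> (laurent \<Rightarrow> complex) \<Rightarrow> bool" where
  "pos_def_functional N M L \<longleftrightarrow>
     linear_functional N M L \<and>
     (\<forall>i j. \<bar>i\<bar> \<le> N \<and> \<bar>j\<bar> \<le> M \<longrightarrow> L (monom_zw (- i) (- j)) = cnj (L (monom_zw i j))) \<and>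
     (\<forall>p\<in>Pi_hat N M. p \<noteq> 0 \<longrightarrow> 0 < L (p * dagger p))"

definition inner_zw :: "(laurent \<Rightarrow> complex) \<Rightarrow> laurent \<Rightarrow> laurent \<Rightarrow> complex" where
  "inner_zw L p q = L (p * dagger q)"

definition mat_inner :: "(laurent \<Rightarrow> complex) \<Rightarrow> laurent mat \<Rightarrow> laurent mat \<Rightarrow> complex mat" where
  "mat_inner L X Y = map_mat L (X * mat_dagger Y)"


section \<open>Orthonormal polynomials\<close>

text \<open>The suffix \<open>t\<close> stands for a tilde, which marks the objects with the roles of \<open>z\<close> and \<open>w\<close> interchanged.\<close>

definition phi_monoms :: "int \<Rightarrow> int \<Rightarrow> int \<Rightarrow> laurent set" where
  "phi_monoms n m l =
     {monom_zw i j | i j. 0 \<le> i \<and> i < n \<and> 0 \<le> j \<and> j \<le> m} \<union>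
     {monom_zw n j | j. 0 \<le> j \<and> j \<le> l}"

definition phi :: "(laurent \<Rightarrow> complex) \<Rightarrow> int \<Rightarrow> int \<Rightarrow> int \<Rightarrow> laurent" where
  "phi L n m l = (THE p. p \<in> laurent.span (phi_monoms n m l) \<and>
     0 < coeff_zw p n l \<and>
     inner_zw L p p = 1 \<and>
     (\<forall>q \<in> phi_monoms n m l - {monom_zw n l}. inner_zw L p q = 0))"

definition phit_monoms :: "int \<Rightarrow> int \<Rightarrow> int \<Rightarrow> laurent set" where
  "phit_monoms n m l =
     {monom_zw i j | i j. 0 \<le> i \<and> i \<le> n \<and> 0 \<le> j \<and> j < m} \<union>
     {monom_zw i m | i. 0 \<le> i \<and> i \<le> l}"

definition phit :: "(laurent \<Rightarrow> complex) \<Rightarrow> int \<Rightarrow> int \<Rightarrow> int \<Rightarrow> laurent" where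
  "phit L n m l = (THE p. p \<in> laurent.span (phit_monoms n m l) \<and>
     0 < coeff_zw p l m \<and>
     inner_zw L p p = 1 \<and>
     (\<forall>q \<in> phit_monoms n m l - {monom_zw l m}. inner_zw L p q = 0))"

text \<open>
  Indices are integers so that \<open>Phi L n (- 1)\<close> and \<open>Phit L (- 1) m\<close> are the empty (zero-row) columns.
\<close>

definition Phi :: "(laurent \<Rightarrow> complex) \<Rightarrow> int \<Rightarrow> int \<Rightarrow> laurent mat" where
  "Phi L n m = mat (nat (m + 1)) 1 (\<lambda>(r, _). phi L n m (m - int r))"

definition Phit :: "(laurent \<Rightarrow> complex) \<Rightarrow> int \<Rightarrow> int \<Rightarrow> laurent mat" where
  "Phit L n m = mat (nat (n + 1)) 1 (\<lambda>(r, _). phit L n m (n - int r))"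

definition Phi_rev :: "(laurent \<Rightarrow> complex) \<Rightarrow> int \<Rightarrow> int \<Rightarrow> laurent mat" where
  "Phi_rev L n m = monom_zw n m \<cdot>\<^sub>m mat_dagger (Phi L n m)"

definition Phit_rev :: "(laurent \<Rightarrow> complex) \<Rightarrow> int \<Rightarrow> int \<Rightarrow> laurent mat" where
  "Phit_rev L n m = monom_zw n m \<cdot>\<^sub>m mat_dagger (Phit L n m)"


section \<open>Recurrence coefficients\<close>

abbreviation z_times :: "laurent mat \<Rightarrow> laurent mat" where
  "z_times X \<equiv> monom_zw 1 0 \<cdot>\<^sub>m X"

abbreviation w_times :: "laurent mat \<Rightarrow> laurent mat" where
  "w_times X \<equiv> monom_zw 0 1 \<cdot>\<^sub>m X"

definition Ehat :: "(laurent \<Rightarrow> complex) \<Rightarrow> int \<Rightarrow> int \<Rightarrow> complex mat" where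
  "Ehat L n m = mat_inner L (z_times (Phi L (n - 1) m)) (transpose_mat (Phi_rev L (n - 1) m))"

definition Amat :: "(laurent \<Rightarrow> complex) \<Rightarrow> int \<Rightarrow> int \<Rightarrow> complex mat" where
  "Amat L n m = mat_inner L (z_times (Phi L (n - 1) m)) (Phi L n m)"

definition Ehat_t :: "(laurent \<Rightarrow> complex) \<Rightarrow> int \<Rightarrow> int \<Rightarrow> complex mat" where
  "Ehat_t L n m = mat_inner L (w_times (Phit L n (m - 1))) (transpose_mat (Phit_rev L n (m - 1)))"

definition Amat_t :: "(laurent \<Rightarrow> complex) \<Rightarrow> int \<Rightarrow> int \<Rightarrow> complex mat" where
  "Amat_t L n m = mat_inner L (w_times (Phit L n (m - 1))) (Phit L n m)"

definition Kmat :: "(laurent \<Rightarrow> complex) \<Rightarrow> int \<Rightarrow> int \<Rightarrow> complex mat" where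
  "Kmat L n m = mat_inner L (Phi L n (m - 1)) (Phit L (n - 1) m)"

definition K1mat :: "(laurent \<Rightarrow> complex) \<Rightarrow> int \<Rightarrow> int \<Rightarrow> complex mat" where
  "K1mat L n m = mat_inner L (w_times (Phi L n (m - 1))) (transpose_mat (Phit_rev L (n - 1) m))"

definition Gamma_mat :: "(laurent \<Rightarrow> complex) \<Rightarrow> int \<Rightarrow> int \<Rightarrow> complex mat" where
  "Gamma_mat L n m = mat_inner L (Phi L n (m - 1)) (Phi L n m)"

definition Gamma_t_mat :: "(laurent \<Rightarrow> complex) \<Rightarrow> int \<Rightarrow> int \<Rightarrow> complex mat" where
  "Gamma_t_mat L n m = mat_inner L (Phit L (n - 1) m) (Phit L n m)"

text \<open>
  \<open>mat_inverse\<close> returns an option, which is \<open>None\<close> for singular matrices; \<open>mat_inv\<close> is meaningful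
  for invertible matrices only.
\<close>

definition mat_inv :: "complex mat \<Rightarrow> complex mat" where
  "mat_inv A = the (mat_inverse A)"

end

theory Submission
  imports Defs "Jordan_Normal_Form.Determinant"
begin

text \<open>
  Expanding \<open>\<Phi>(n,m-2)\<close> in the orthonormal polynomials \<open>\<Phi>(n,m-1)\<close> and \<open>\<Phi>t(n-1,m-1)\<close>, the only degrees of
  freedom left by its orthogonality relations, gives
  \<open>\<Gamma>(n,m-1) \<Phi>(n,m-1) = \<Phi>(n,m-2) - K(n,m-1) \<Phi>t(n-1,m-1)\<close>.
  In the same way one gets the Szego type recurrence expressing \<open>At(n-1,m) \<Phi>t(n-1,m)\<close> by \<open>w \<Phi>t(n-1,m-1)\<close>
  and the reversal of \<open>\<Phi>t(n-1,m-1)\<close>. The inner product of \<open>w\<close> times the first relation with the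
  reversal of the second one is the first claim multiplied by the transpose of \<open>At(n-1,m)\<close>; two of the
  terms cancel because \<open>Et(n-1,m)\<close> is symmetric. The second claim is the transpose of the first one
  for the functional with \<open>z\<close> and \<open>w\<close> interchanged.
\<close>

text \<open>Neither expansion is obtained by counting dimensions. In each case the defect
  \<open>V\<close>, the difference of the two sides, has coefficients chosen as inner products
  against mutually orthogonal orthonormal columns, so \<open>V\<close> is orthogonal to those
  columns. The orthogonality of \<open>V\<close> to monomials is then spread from a smaller
  rectangle of exponents to the full one, and positivity forces \<open>V = 0\<close>. Conjugations
  explain the shape of the result. Reversal conjugates the coefficients of the recurrence for
  \<open>Phit\<close>, and the second argument of the inner product conjugates them once more, so
  the matrices of that recurrence enter as plain transposes. Under the interchange of z and w,
  however, the matrix \<open>Kmat\<close> turns into its adjoint while \<open>K1mat\<close> turns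
  into its transpose; this is the origin of the bar in the second claim.\<close>

abbreviation lcoeff :: "laurent \<Rightarrow> int \<times> int \<Rightarrow> complex" where
  "lcoeff \<equiv> Poly_Mapping.lookup"

abbreviation lsupp :: "laurent \<Rightarrow> (int \<times> int) set" where
  "lsupp \<equiv> Poly_Mapping.keys"

abbreviation mon :: "int \<times> int \<Rightarrow> laurent" where
  "mon e \<equiv> Poly_Mapping.single e 1"

abbreviation const :: "complex \<Rightarrow> laurent" where
  "const \<equiv> Poly_Mapping.single 0"

abbreviation const_mat :: "complex mat \<Rightarrow> laurent mat" where
  "const_mat \<equiv> map_mat const"

section \<open>Laurent polynomials: terms and the involutions \<open>dagger\<close> and
  \<open>swap_zw\<close>\<close>

lemma lcoeff_const_mult [simp]: "lcoeff (const c * p) e = c * lcoeff p e"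
  by (simp flip: mult_map_scale_conv_mult add: map.rep_eq when_def)

lemma laurent_expansion: "p = (\<Sum>e\<in>lsupp p. const (lcoeff p e) * mon e)"
proof (rule poly_mapping_eqI)
  fix k
  show "lcoeff p k = lcoeff (\<Sum>e\<in>lsupp p. const (lcoeff p e) * mon e) k"
    by (simp add: lookup_sum mult_single lookup_single when_def in_keys_iff)
qed

text \<open>Cancellation forces additive maps to send 0 to 0, so agreement on single terms passes to
  finite sums of terms, hence to every Laurent polynomial.\<close>

lemma additive_ext_single:
  fixes f g :: "laurent \<Rightarrow> 'b::cancel_comm_monoid_add"
  assumes f: "\<And>p q. f (p + q) = f p + f q" and g: "\<And>p q. g (p + q) = g p + g q"
    and eq: "\<And>e c. f (Poly_Mapping.single e c) = g (Poly_Mapping.single e c)"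
  shows "f p = g p"
proof -
  have f0: "f 0 = 0" using f[of 0 0] by simp
  have g0: "g 0 = 0" using g[of 0 0] by simp
  have "f (sum h A) = g (sum h A)" if "\<And>a. a \<in> A \<Longrightarrow> f (h a) = g (h a)" for h and A :: "(int\<times>int) set"
    using that by (induction A rule: infinite_finite_induct) (simp_all add: f0 g0 f g)
  from this[of "lsupp p" "\<lambda>e. const (lcoeff p e) * mon e"] show ?thesis
    using eq by (simp add: mult_single flip: laurent_expansion[of p, simplified mult_single, simplified])
qed

text \<open>Both sides are additive in each factor separately, so the extension principle applies
  once per factor. It serves \<open>dagger\<close> and \<open>swap_zw\<close>, which are given
  coefficientwise and say nothing directly about convolution.\<close>

lemma multiplicative_ext_single:
  fixes f :: "laurent \<Rightarrow> laurent"
  assumes f: "\<And>p q. f (p + q) = f p + f q"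
    and eq: "\<And>e c e' c'. f (Poly_Mapping.single e c * Poly_Mapping.single e' c') =
              f (Poly_Mapping.single e c) * f (Poly_Mapping.single e' c')"
  shows "f (p * q) = f p * f q"
proof (rule additive_ext_single[where f = "\<lambda>p. f (p * q)" and g = "\<lambda>p. f p * f q"])
  fix e c
  show "f (Poly_Mapping.single e c * q) = f (Poly_Mapping.single e c) * f q"
    by (rule additive_ext_single[where f = "\<lambda>q. f (Poly_Mapping.single e c * q)"
          and g = "\<lambda>q. f (Poly_Mapping.single e c) * f q"])
       (simp_all add: eq f distrib_left)
qed (simp_all add: f distrib_right)

lemma lcoeff_dagger: "lcoeff (dagger p) e = cnj (lcoeff p (- e))"
  by (simp add: dagger_def map_key.rep_eq map.rep_eq when_def)

lemma lsupp_dagger: "lsupp (dagger p) = uminus ` lsupp p"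
proof -
  have "e \<in> lsupp (dagger p) \<longleftrightarrow> e \<in> uminus ` lsupp p" for e
    by (auto simp: in_keys_iff lcoeff_dagger intro!: image_eqI[of _ _ "- e"])
  then show ?thesis by blast
qed

lemma dagger_add [simp]: "dagger (p + q) = dagger p + dagger q"
  by (rule poly_mapping_eqI) (simp add: lcoeff_dagger lookup_add)

lemma dagger_0 [simp]: "dagger 0 = 0"
  by (rule poly_mapping_eqI) (simp add: lcoeff_dagger)

lemma dagger_diff [simp]: "dagger (p - q) = dagger p - dagger q"
  by (rule poly_mapping_eqI) (simp add: lcoeff_dagger lookup_minus)

lemma dagger_dagger [simp]: "dagger (dagger p) = p"
  by (rule poly_mapping_eqI) (simp add: lcoeff_dagger)

lemma dagger_single [simp]: "dagger (Poly_Mapping.single e c) = Poly_Mapping.single (- e) (cnj c)"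
  by (rule poly_mapping_eqI)
     (auto simp: lcoeff_dagger lookup_single when_def prod_eq_iff)

lemma dagger_mult [simp]: "dagger (p * q) = dagger p * dagger q"
  by (rule multiplicative_ext_single) (simp_all add: mult_single)

lemma dagger_sum: "dagger (sum f A) = (\<Sum>a\<in>A. dagger (f a))"
  by (induction A rule: infinite_finite_induct) simp_all

definition swap_zw :: "laurent \<Rightarrow> laurent" where
  "swap_zw = Poly_Mapping.map_key prod.swap"

lemma lcoeff_swap: "lcoeff (swap_zw p) e = lcoeff p (prod.swap e)"
  by (simp add: swap_zw_def map_key.rep_eq)

lemma lsupp_swap: "lsupp (swap_zw p) = prod.swap ` lsupp p"
proof -
  have "e \<in> lsupp (swap_zw p) \<longleftrightarrow> e \<in> prod.swap ` lsupp p" for e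
    by (auto simp: in_keys_iff lcoeff_swap intro!: image_eqI[of _ _ "prod.swap e"])
  then show ?thesis by blast
qed

lemma swap_add [simp]: "swap_zw (p + q) = swap_zw p + swap_zw q"
  by (rule poly_mapping_eqI) (simp add: lcoeff_swap lookup_add)

lemma swap_eq_0 [simp]: "swap_zw p = 0 \<longleftrightarrow> p = 0"
  by (metis (no_types) image_is_empty keys_eq_empty lsupp_swap)

lemma swap_swap [simp]: "swap_zw (swap_zw p) = p"
  by (rule poly_mapping_eqI) (simp add: lcoeff_swap)

lemma swap_single [simp]: "swap_zw (Poly_Mapping.single e c) = Poly_Mapping.single (prod.swap e) c"
  by (rule poly_mapping_eqI) (auto simp: lcoeff_swap lookup_single when_def prod_eq_iff)

lemma swap_mult [simp]: "swap_zw (p * q) = swap_zw p * swap_zw q"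
  by (rule multiplicative_ext_single) (simp_all add: mult_single plus_prod_def)

lemma dagger_swap: "dagger (swap_zw p) = swap_zw (dagger p)"
  by (rule poly_mapping_eqI) (simp add: lcoeff_swap lcoeff_dagger prod.swap_def)

section \<open>Spans of monomials as support conditions\<close>

lemma monom_zw_eq: "monom_zw i j = mon (i, j)"
  by (simp add: monom_zw_def)

text \<open>Turns every span in the definitions into an inclusion of supports, so that membership
  arguments become computations with sets of exponents.\<close>

lemma span_monom: "laurent.span (mon ` S) = {p. lsupp p \<subseteq> S}"
proof (intro subset_antisym subsetI)
  have "lsupp (p + q) \<subseteq> S" if "lsupp p \<subseteq> S" "lsupp q \<subseteq> S" for p q
    using keys_add[of p q] that by blast
  moreover have "lsupp (const c * p) \<subseteq> S" if "lsupp p \<subseteq> S" for c p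
    using that by (auto simp: in_keys_iff)
  ultimately have "laurent.subspace {p. lsupp p \<subseteq> S}"
    by (simp add: laurent.subspace_def scale_zw_def)
  then have "laurent.span (mon ` S) \<subseteq> {p. lsupp p \<subseteq> S}"
    by (intro laurent.span_minimal) auto
  then show "p \<in> {p. lsupp p \<subseteq> S}" if "p \<in> laurent.span (mon ` S)" for p
    using that by blast
next
  fix p assume "p \<in> {p. lsupp p \<subseteq> S}"
  then have "(\<Sum>e\<in>lsupp p. scale_zw (lcoeff p e) (mon e)) \<in> laurent.span (mon ` S)"
    by (intro laurent.span_sum laurent.span_scale laurent.span_base) auto
  then show "p \<in> laurent.span (mon ` S)"
    by (simp add: scale_zw_def flip: laurent_expansion)
qed

abbreviation box :: "int \<Rightarrow> int \<Rightarrow> (int \<times> int) set" where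
  "box n m \<equiv> {0..n} \<times> {0..m}"

lemma Pi_space_eq: "Pi_space N M = {p. lsupp p \<subseteq> {-N..N} \<times> {-M..M}}"
proof -
  have "{monom_zw i j | i j. \<bar>i\<bar> \<le> N \<and> \<bar>j\<bar> \<le> M} = mon ` ({-N..N} \<times> {-M..M})"
    by (force simp: monom_zw_eq abs_le_iff image_iff)
  then show ?thesis by (simp add: Pi_space_def span_monom)
qed

lemma Pi_hat_eq: "Pi_hat N M = {p. lsupp p \<subseteq> box N M}"
proof -
  have "{monom_zw i j | i j. 0 \<le> i \<and> i \<le> N \<and> 0 \<le> j \<and> j \<le> M} = mon ` box N M"
    by (force simp: monom_zw_eq image_iff)
  then show ?thesis by (simp add: Pi_hat_def span_monom)
qed

lemma lsupp_add_subset: "lsupp p \<subseteq> S \<Longrightarrow> lsupp q \<subseteq> S \<Longrightarrow> lsupp (p + q) \<subseteq> S"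
  using keys_add[of p q] by blast

lemma lsupp_diff_subset: "lsupp p \<subseteq> S \<Longrightarrow> lsupp q \<subseteq> S \<Longrightarrow> lsupp (p - q) \<subseteq> S"
  using keys_diff[of p q] by blast

lemma lsupp_const_subset: "lsupp p \<subseteq> S \<Longrightarrow> lsupp (const c * p) \<subseteq> S"
  by (auto simp: in_keys_iff)

lemma lsupp_remove: "lsupp p \<subseteq> S \<Longrightarrow> lcoeff p e = 0 \<Longrightarrow> lsupp p \<subseteq> S - {e}"
  by (auto simp: in_keys_iff)

section \<open>The sesquilinear form of a globally Hermitian functional\<close>

locale hermitian_functional =
  fixes L :: "laurent \<Rightarrow> complex"
  assumes L_add: "L (p + q) = L p + L q"
    and L_const: "L (const c * p) = c * L p"
    and L_dagger: "L (dagger p) = cnj (L p)"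
begin

abbreviation ip :: "laurent \<Rightarrow> laurent \<Rightarrow> complex" where
  "ip \<equiv> inner_zw L"

lemma L_diff: "L (p - q) = L p - L q"
  using L_add[of "p - q" q] by simp

lemma L_0 [simp]: "L 0 = 0"
  using L_add[of 0 0] by simp

lemma L_sum: "L (sum f A) = (\<Sum>a\<in>A. L (f a))"
  by (induction A rule: infinite_finite_induct) (simp_all add: L_add)

lemma ip_commute: "ip q p = cnj (ip p q)"
  by (simp add: inner_zw_def mult.commute flip: L_dagger)

lemma ip_add_left: "ip (p + p') q = ip p q + ip p' q"
  by (simp add: inner_zw_def distrib_right L_add)

lemma ip_diff_left: "ip (p - p') q = ip p q - ip p' q"
  by (simp add: inner_zw_def left_diff_distrib L_diff)

lemma ip_const_left: "ip (const c * p) q = c * ip p q"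
  by (simp add: inner_zw_def mult.assoc L_const)

lemma ip_diff_right: "ip q (p - p') = ip q p - ip q p'"
  by (simp add: inner_zw_def right_diff_distrib L_diff)

lemma ip_const_right: "ip q (const c * p) = cnj c * ip q p"
  by (metis complex_cnj_mult ip_commute ip_const_left)

lemma ip_sum_left: "ip (sum f A) q = (\<Sum>a\<in>A. ip (f a) q)"
  by (simp add: inner_zw_def sum_distrib_right L_sum)

lemma ip_sum_right: "ip q (sum f A) = (\<Sum>a\<in>A. ip q (f a))"
  by (simp add: inner_zw_def dagger_sum sum_distrib_left L_sum)

lemma ip_mon_mult: "ip (mon e * p) q = ip p (mon (- e) * q)"
  by (simp add: inner_zw_def ac_simps)

lemma mon_mult_cancel: "mon (- e) * (mon e * p) = p" "mon e * (mon (- e) * p) = p"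
  by (simp_all add: mult_single flip: mult.assoc)

lemma ip_mon_mult_both: "ip (mon e * p) (mon e * q) = ip p q"
  by (simp add: ip_mon_mult mon_mult_cancel)

text \<open>Reversal is antiunitary: a monomial shift preserves the form, and \<open>dagger\<close>
  exchanges its arguments because multiplication is commutative. Hence reversed orthonormal columns
  are orthonormal again.\<close>

lemma ip_reverse: "ip (mon e * dagger p) (mon e * dagger q) = ip q p"
  by (simp add: ip_mon_mult_both) (simp add: inner_zw_def mult.commute)

lemma ip_eq_0_supp:
  assumes "\<And>e. e \<in> S \<Longrightarrow> ip p (mon e) = 0" "lsupp q \<subseteq> S"
  shows "ip p q = 0"
  by (subst laurent_expansion[of q], subst ip_sum_right, rule sum.neutral)
     (use assms in \<open>auto simp: ip_const_right\<close>)

end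

text \<open>Covers \<open>phi\<close> and \<open>phit\<close> at once: they differ only in the
  exponent set and the leading exponent, so existence, uniqueness and completeness need a single
  proof.\<close>

definition is_orthopoly :: "(laurent \<Rightarrow> complex) \<Rightarrow> (int \<times> int) set \<Rightarrow> int \<times> int \<Rightarrow> laurent \<Rightarrow> bool" where
  "is_orthopoly L S e p \<longleftrightarrow> lsupp p \<subseteq> S \<and> 0 < lcoeff p e \<and> inner_zw L p p = 1 \<and>
     (\<forall>f\<in>S - {e}. inner_zw L p (mon f) = 0)"

definition phi_exps :: "int \<Rightarrow> int \<Rightarrow> int \<Rightarrow> (int \<times> int) set" where
  "phi_exps n m l = {0..<n} \<times> {0..m} \<union> {n} \<times> {0..l}"

definition phit_exps :: "int \<Rightarrow> int \<Rightarrow> int \<Rightarrow> (int \<times> int) set" where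
  "phit_exps n m l = {0..n} \<times> {0..<m} \<union> {0..l} \<times> {m}"

lemma mon_eq_iff [simp]: "mon e = mon f \<longleftrightarrow> e = f"
  by (metis keys_single singleton_inject zero_neq_one)

lemma phi_monoms_eq: "phi_monoms n m l = mon ` phi_exps n m l"
  by (auto simp: phi_monoms_def phi_exps_def monom_zw_eq image_Un)

lemma phit_monoms_eq: "phit_monoms n m l = mon ` phit_exps n m l"
  by (auto simp: phit_monoms_def phit_exps_def monom_zw_eq image_Un)

lemma mon_image_diff: "mon ` S - {mon e} = mon ` (S - {e})"
  by auto

lemma phi_eq: "phi L n m l = (THE p. is_orthopoly L (phi_exps n m l) (n, l) p)"
  unfolding phi_def is_orthopoly_def phi_monoms_eq span_monom monom_zw_eq mon_image_diff by simp

lemma phit_eq: "phit L n m l = (THE p. is_orthopoly L (phit_exps n m l) (l, m) p)"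
  unfolding phit_def is_orthopoly_def phit_monoms_eq span_monom monom_zw_eq mon_image_diff by simp

text \<open>Since \<open>p\<close> has a nonzero coefficient at \<open>e\<close>, the monomial
  \<open>mon e\<close> is a combination of \<open>p\<close> and monomials from
  \<open>S - {e}\<close>. This is the single step of the completeness arguments.\<close>

lemma (in hermitian_functional) is_orthopoly_complete:
  assumes p: "is_orthopoly L S e p" and S: "\<And>f. f \<in> S - {e} \<Longrightarrow> ip v (mon f) = 0"
    and v: "ip v p = 0"
  shows "ip v (mon e) = 0"
proof -
  define r where "r = p - const (lcoeff p e) * mon e"
  have "e \<in> S"
    using p by (auto simp: is_orthopoly_def in_keys_iff)
  then have "lsupp r \<subseteq> S - {e}"
    unfolding r_def using p
    by (intro lsupp_remove lsupp_diff_subset lsupp_const_subset)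
       (simp_all add: is_orthopoly_def lookup_minus)
  then have "ip v r = 0"
    using S ip_eq_0_supp by blast
  then have "cnj (lcoeff p e) * ip v (mon e) = 0"
    using v by (simp add: r_def ip_diff_right ip_const_right)
  then show ?thesis
    using p by (auto simp: is_orthopoly_def)
qed

section \<open>Positivity: existence and uniqueness of orthonormal polynomials\<close>

locale positive_functional = hermitian_functional +
  fixes N M :: int
  assumes L_pos: "lsupp p \<subseteq> box N M \<Longrightarrow> p \<noteq> 0 \<Longrightarrow> 0 < L (p * dagger p)"
begin

lemma ip_pos: "lsupp p \<subseteq> box N M \<Longrightarrow> p \<noteq> 0 \<Longrightarrow> 0 < ip p p"
  by (simp add: inner_zw_def L_pos)

lemma orthogonal_self_eq_0:
  assumes "lsupp p \<subseteq> S" "S \<subseteq> box N M" "\<And>e. e \<in> S \<Longrightarrow> ip p (mon e) = 0"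
  shows "p = 0"
proof (rule ccontr)
  assume "p \<noteq> 0"
  then have "0 < ip p p" using assms by (intro ip_pos) auto
  moreover have "ip p p = 0" by (rule ip_eq_0_supp[OF assms(3,1)])
  ultimately show False by simp
qed

text \<open>Gram-Schmidt by induction on \<open>T\<close>: the projection is corrected along one new
  direction orthogonal to the old monomials. The vector \<open>v\<close> is generalised because the
  hypothesis is used both for \<open>v\<close> and for the new monomial.\<close>

lemma orthogonal_projection:
  assumes "finite T" "T \<subseteq> box N M"
  shows "\<exists>u. lsupp u \<subseteq> T \<and> (\<forall>f\<in>T. ip (v - u) (mon f) = 0)"
  using assms
proof (induction T arbitrary: v)
  case empty
  show ?case by (intro exI[of _ 0]) simp
next
  case (insert e T)
  then obtain p u where p: "lsupp p \<subseteq> T" "\<And>f. f \<in> T \<Longrightarrow> ip (mon e - p) (mon f) = 0"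
    and u: "lsupp u \<subseteq> T" "\<And>f. f \<in> T \<Longrightarrow> ip (v - u) (mon f) = 0"
    by (metis insert_subset)
  \<comment> \<open>The new direction. Its coefficient at \<open>e\<close> is 1, because
    \<open>p\<close> is supported in \<open>T\<close> and \<open>e\<close> is not in
    \<open>T\<close>; so it is nonzero and can be divided by its norm.\<close>
  define r where "r = mon e - p"
  have r: "lsupp r \<subseteq> insert e T"
    unfolding r_def using p(1) by (intro lsupp_diff_subset) auto
  have "lcoeff r e = 1"
    using p(1) insert.hyps by (auto simp: r_def lookup_minus in_keys_iff)
  then have "r \<noteq> 0" by auto
  then have "ip r r \<noteq> 0"
    using ip_pos[of r] subset_trans[OF r insert.prems] by force
  define c where "c = ip (v - u) r / ip r r"
  define u' where "u' = u + const c * r"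
  have 1: "ip (v - u') (mon f) = 0" if "f \<in> T" for f
    using that p(2) u(2) by (simp add: u'_def ip_diff_left ip_add_left ip_const_left r_def)
  have 2: "ip (v - u') r = 0"
    using \<open>ip r r \<noteq> 0\<close> by (simp add: u'_def c_def ip_diff_left ip_add_left ip_const_left)
  have "ip (v - u') p = 0"
    using 1 p(1) by (rule ip_eq_0_supp)
  with 2 have "ip (v - u') (mon e) = 0"
    by (simp add: r_def ip_diff_right)
  moreover have "lsupp u' \<subseteq> insert e T"
    unfolding u'_def using u(1) r by (intro lsupp_add_subset lsupp_const_subset) auto
  ultimately show ?case
    using 1 by blast
qed

lemma is_orthopoly_exists:
  assumes S: "finite S" "S \<subseteq> box N M" "e \<in> S"
  shows "\<exists>p. is_orthopoly L S e p"
proof -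
  obtain u where u: "lsupp u \<subseteq> S - {e}" "\<And>f. f \<in> S - {e} \<Longrightarrow> ip (mon e - u) (mon f) = 0"
    using orthogonal_projection[of "S - {e}" "mon e"] S by blast
  define r where "r = mon e - u"
  have r: "lsupp r \<subseteq> S"
    unfolding r_def using u(1) S by (intro lsupp_diff_subset) auto
  have re: "lcoeff r e = 1"
    using u(1) by (auto simp: r_def lookup_minus in_keys_iff)
  then have "r \<noteq> 0" by auto
  then have "0 < ip r r"
    using ip_pos[of r] r S by auto
  \<comment> \<open>Positivity in the order on complex numbers includes being real, which makes the
    normalising factor \<open>1 / sqrt a\<close> available.\<close>
  then obtain a :: real where a: "ip r r = of_real a" "0 < a"
    by (metis complex_is_Real_iff less_complex_def of_real_Re zero_complex.simps)
  define p where "p = const (of_real (1 / sqrt a)) * r"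
  have "ip p p = of_real ((1 / sqrt a) * (1 / sqrt a) * a)"
    by (simp only: p_def ip_const_left ip_const_right a of_real_mult complex_cnj_complex_of_real mult.assoc)
  also have "\<dots> = 1"
    using a(2) by simp
  finally have "ip p p = 1" .
  then have "is_orthopoly L S e p"
    using re u(2) a(2) lsupp_const_subset[OF r]
    by (simp add: is_orthopoly_def p_def ip_const_left less_complex_def flip: r_def)
  then show ?thesis ..
qed

lemma is_orthopoly_unique:
  assumes S: "S \<subseteq> box N M" and p: "is_orthopoly L S e p" and q: "is_orthopoly L S e q"
  shows "p = q"
proof -
  obtain a b :: real where a: "lcoeff p e = of_real a" "0 < a" and b: "lcoeff q e = of_real b" "0 < b"
    using p q unfolding is_orthopoly_def
    by (metis complex_is_Real_iff less_complex_def of_real_Re zero_complex.simps)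
  \<comment> \<open>Cross-multiplication by the leading coefficients removes the exponent
    \<open>e\<close>. What remains is supported on \<open>S - {e}\<close>, where both
    \<open>p\<close> and \<open>q\<close> are orthogonal, so it vanishes; comparing norms then gives
    \<open>b = a\<close>.\<close>
  define d where "d = const (of_real b) * p - const (of_real a) * q"
  have "d = 0"
  proof (rule orthogonal_self_eq_0)
    show "lsupp d \<subseteq> S - {e}"
      unfolding d_def using p q a b
      by (intro lsupp_remove lsupp_diff_subset lsupp_const_subset)
         (simp_all add: is_orthopoly_def lookup_minus)
    show "S - {e} \<subseteq> box N M" using S by blast
    show "ip d (mon f) = 0" if "f \<in> S - {e}" for f
      using that p q by (simp add: d_def is_orthopoly_def ip_diff_left ip_const_left)
  qed
  then have eq: "const (of_real b) * p = const (of_real a) * q"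
    by (simp add: d_def)
  have "ip (const (of_real b) * p) (const (of_real b) * p) = of_real (b * b)"
    using p by (simp add: ip_const_left ip_const_right is_orthopoly_def)
  moreover have "ip (const (of_real a) * q) (const (of_real a) * q) = of_real (a * a)"
    using q by (simp add: ip_const_left ip_const_right is_orthopoly_def)
  ultimately have "b * b = a * a"
    using eq by (metis of_real_eq_iff)
  then have "b = a"
    using a b by (metis less_eq_real_def power2_eq_iff_nonneg power2_eq_square)
  show ?thesis
  proof (rule poly_mapping_eqI)
    fix k
    have "lcoeff (const (of_real b) * p) k = lcoeff (const (of_real a) * q) k" by (simp add: eq)
    then show "lcoeff p k = lcoeff q k" using \<open>b = a\<close> a by simp
  qed
qed

lemma is_orthopoly_THE:
  assumes "finite S" "S \<subseteq> box N M" "e \<in> S"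
  shows "is_orthopoly L S e (THE p. is_orthopoly L S e p)"
  using is_orthopoly_exists[OF assms] is_orthopoly_unique[OF assms(2)] by (metis theI)

lemma is_orthopoly_phi:
  assumes "0 \<le> n" "n \<le> N" "m \<le> M" "0 \<le> l" "l \<le> m"
  shows "is_orthopoly L (phi_exps n m l) (n, l) (phi L n m l)"
  unfolding phi_eq by (rule is_orthopoly_THE) (use assms in \<open>auto simp: phi_exps_def\<close>)

lemma is_orthopoly_phit:
  assumes "0 \<le> m" "n \<le> N" "m \<le> M" "0 \<le> l" "l \<le> n"
  shows "is_orthopoly L (phit_exps n m l) (l, m) (phit L n m l)"
  unfolding phit_eq by (rule is_orthopoly_THE) (use assms in \<open>auto simp: phit_exps_def\<close>)

end

section \<open>Columns of Laurent polynomials, reversals and supports\<close>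

lemma dim_mat_inner [simp]:
  "dim_row (mat_inner L X Y) = dim_row X" "dim_col (mat_inner L X Y) = dim_row Y"
  by (simp_all add: mat_inner_def mat_dagger_def)

lemma mat_inner_index:
  assumes "dim_col X = 1" "dim_col Y = 1" "i < dim_row X" "j < dim_row Y"
  shows "mat_inner L X Y $$ (i, j) = inner_zw L (X $$ (i, 0)) (Y $$ (j, 0))"
  using assms by (simp add: mat_inner_def mat_dagger_def inner_zw_def scalar_prod_def)

lemma const_mat_mult_index:
  assumes "dim_col C = dim_row X" "dim_col X = 1" "i < dim_row C"
  shows "(const_mat C * X) $$ (i, 0) = (\<Sum>j<dim_row X. const (C $$ (i, j)) * X $$ (j, 0))"
  using assms by (simp add: scalar_prod_def lessThan_atLeast0)

text \<open>The reversal as a column instead of a row, with a free exponent: it can be applied to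
  both sides of a recurrence and composed with itself.\<close>

definition rev_mat :: "int \<times> int \<Rightarrow> laurent mat \<Rightarrow> laurent mat" where
  "rev_mat e X = mon e \<cdot>\<^sub>m map_mat dagger X"

lemma dim_rev_mat [simp]: "dim_row (rev_mat e X) = dim_row X" "dim_col (rev_mat e X) = dim_col X"
  by (simp_all add: rev_mat_def)

lemma transpose_Phi_rev: "transpose_mat (Phi_rev L n m) = rev_mat (n, m) (Phi L n m)"
  by (rule eq_matI) (simp_all add: Phi_rev_def rev_mat_def mat_dagger_def monom_zw_eq)

lemma transpose_Phit_rev: "transpose_mat (Phit_rev L n m) = rev_mat (n, m) (Phit L n m)"
  by (rule eq_matI) (simp_all add: Phit_rev_def rev_mat_def mat_dagger_def monom_zw_eq)

lemma dim_Phi [simp]: "dim_row (Phi L n m) = nat (m + 1)" "dim_col (Phi L n m) = 1"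
  by (simp_all add: Phi_def)

lemma dim_Phit [simp]: "dim_row (Phit L n m) = nat (n + 1)" "dim_col (Phit L n m) = 1"
  by (simp_all add: Phit_def)

lemma Phi_index: "r < nat (m + 1) \<Longrightarrow> Phi L n m $$ (r, 0) = phi L n m (m - int r)"
  by (simp add: Phi_def)

lemma Phit_index: "r < nat (n + 1) \<Longrightarrow> Phit L n m $$ (r, 0) = phit L n m (n - int r)"
  by (simp add: Phit_def)

definition supp_in :: "laurent mat \<Rightarrow> (int \<times> int) set \<Rightarrow> bool" where
  "supp_in X S \<longleftrightarrow> (\<forall>i<dim_row X. lsupp (X $$ (i, 0)) \<subseteq> S)"

lemma supp_in_mono: "supp_in X S \<Longrightarrow> S \<subseteq> T \<Longrightarrow> supp_in X T"
  by (auto simp: supp_in_def)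

lemma supp_in_diff:
  assumes "supp_in X S" "supp_in Y S" "dim_row X = dim_row Y" "dim_col X = 1" "dim_col Y = 1"
  shows "supp_in (X - Y) S"
  using assms unfolding supp_in_def by (simp add: lsupp_diff_subset)

lemma lsupp_sum_subset: "(\<And>a. a \<in> A \<Longrightarrow> lsupp (f a) \<subseteq> S) \<Longrightarrow> lsupp (sum f A) \<subseteq> S"
  using keys_sum[of f A] by blast

lemma supp_in_const_mult:
  assumes "supp_in X S" "dim_col C = dim_row X" "dim_col X = 1"
  shows "supp_in (const_mat C * X) S"
  unfolding supp_in_def
proof (intro allI impI)
  fix i assume "i < dim_row (const_mat C * X)"
  then have i: "i < dim_row C" by simp
  show "lsupp ((const_mat C * X) $$ (i, 0)) \<subseteq> S"
    unfolding const_mat_mult_index[OF assms(2,3) i] using assms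
    by (intro lsupp_sum_subset lsupp_const_subset) (simp add: supp_in_def)
qed

lemma lsupp_mon_mult: "lsupp (mon e * p) \<subseteq> (+) e ` lsupp p"
proof
  fix f assume "f \<in> lsupp (mon e * p)"
  then obtain g where "f = e + g" "g \<in> lsupp p"
    using keys_mult[of "mon e" p] by auto
  then show "f \<in> (+) e ` lsupp p" by blast
qed

lemma supp_in_smult:
  assumes "supp_in X S" "(+) e ` S \<subseteq> T" "dim_col X = 1"
  shows "supp_in (mon e \<cdot>\<^sub>m X) T"
  unfolding supp_in_def
proof (intro allI impI)
  fix i assume "i < dim_row (mon e \<cdot>\<^sub>m X)"
  then have "lsupp (X $$ (i, 0)) \<subseteq> S" "(mon e \<cdot>\<^sub>m X) $$ (i, 0) = mon e * X $$ (i, 0)"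
    using assms by (simp_all add: supp_in_def)
  then show "lsupp ((mon e \<cdot>\<^sub>m X) $$ (i, 0)) \<subseteq> T"
    using lsupp_mon_mult[of e "X $$ (i, 0)"] assms(2) by (simp only:) blast
qed

lemma supp_in_rev_mat:
  assumes "supp_in X S" "(\<lambda>f. e - f) ` S \<subseteq> T" "dim_col X = 1"
  shows "supp_in (rev_mat e X) T"
  unfolding rev_mat_def
proof (rule supp_in_smult)
  show "supp_in (map_mat dagger X) (uminus ` S)"
    using assms unfolding supp_in_def by (simp add: lsupp_dagger image_mono)
qed (use assms in \<open>auto simp: image_image\<close>)

text \<open>
  A functional is linear and Hermitian on \<open>Pi_space N M\<close> only; replacing it by zero on the other
  monomials makes both properties global, without changing any of the coefficients involved.
\<close>
definition truncated :: "int \<Rightarrow> int \<Rightarrow> (laurent \<Rightarrow> complex) \<Rightarrow> laurent \<Rightarrow> complex" where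
  "truncated N M L p = (\<Sum>e\<in>{-N..N} \<times> {-M..M}. lcoeff p e * L (mon e))"

lemma truncated_eq:
  assumes L: "linear_functional N M L" and p: "lsupp p \<subseteq> {-N..N} \<times> {-M..M}"
  shows "truncated N M L p = L p"
proof -
  let ?S = "{p. lsupp p \<subseteq> {-N..N} \<times> {-M..M}}"
  have add: "L (p + q) = L p + L q" if "p \<in> ?S" "q \<in> ?S" for p q
    using L that by (simp add: linear_functional_def Pi_space_eq)
  have const: "L (const c * p) = c * L p" if "p \<in> ?S" for c p
    using L that by (simp add: linear_functional_def Pi_space_eq scale_zw_def)
  have L0: "L 0 = 0" using const[of 0 0] by simp
  have sum: "L (sum f A) = (\<Sum>a\<in>A. L (f a))" if "\<And>a. a \<in> A \<Longrightarrow> f a \<in> ?S" for f and A :: "(int \<times> int) set"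
    using that
    by (induction A rule: infinite_finite_induct) (simp_all add: L0 add lsupp_sum_subset)
  have "L p = L (\<Sum>e\<in>lsupp p. const (lcoeff p e) * mon e)"
    by (simp flip: laurent_expansion)
  also have "\<dots> = (\<Sum>e\<in>lsupp p. L (const (lcoeff p e) * mon e))"
    by (rule sum) (use p in \<open>auto intro!: lsupp_const_subset\<close>)
  also have "\<dots> = (\<Sum>e\<in>lsupp p. lcoeff p e * L (mon e))"
    by (rule sum.cong) (use p in \<open>auto intro!: const\<close>)
  also have "\<dots> = truncated N M L p"
    unfolding truncated_def by (rule sum.mono_neutral_left) (use p in \<open>auto simp: in_keys_iff\<close>)
  finally show ?thesis ..
qed

text \<open>The exponents are differences of two points of the box. This is why inner products of
  polynomials supported in the box involve only values of \<open>L\<close> on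
  \<open>Pi_space N M\<close>.\<close>

lemma lsupp_mult_dagger:
  assumes "lsupp p \<subseteq> box N M" "lsupp q \<subseteq> box N M"
  shows "lsupp (p * dagger q) \<subseteq> {-N..N} \<times> {-M..M}"
proof
  fix e assume "e \<in> lsupp (p * dagger q)"
  then obtain a b where "e = a - b" "a \<in> lsupp p" "b \<in> lsupp q"
    using keys_mult[of p "dagger q"] by (auto simp: lsupp_dagger)
  moreover from this assms have "a \<in> box N M" "b \<in> box N M" by auto
  ultimately show "e \<in> {-N..N} \<times> {-M..M}" by auto
qed

lemma inner_zw_truncated:
  assumes "linear_functional N M L" "lsupp p \<subseteq> box N M" "lsupp q \<subseteq> box N M"
  shows "inner_zw (truncated N M L) p q = inner_zw L p q"
  using assms by (simp add: inner_zw_def truncated_eq lsupp_mult_dagger)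

lemma positive_functional_truncated:
  assumes "pos_def_functional N M L"
  shows "positive_functional (truncated N M L) N M"
proof
  let ?S = "{-N..N} \<times> {-M..M}"
  note L = assms[unfolded pos_def_functional_def]
  show "truncated N M L (p + q) = truncated N M L p + truncated N M L q" for p q
    by (simp add: truncated_def lookup_add distrib_right sum.distrib)
  show "truncated N M L (const c * p) = c * truncated N M L p" for c p
    by (simp add: truncated_def sum_distrib_left mult.assoc)
  show "truncated N M L (dagger p) = cnj (truncated N M L p)" for p
  proof -
    \<comment> \<open>The range of exponents is symmetric under negation, so the sum can be
      reindexed before the Hermitian symmetry of \<open>L\<close> on monomials is used.\<close>
    have "truncated N M L (dagger p) = (\<Sum>e\<in>?S. lcoeff (dagger p) (- e) * L (mon (- e)))"
      unfolding truncated_def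
      by (rule sum.reindex_bij_witness[of _ uminus uminus]) auto
    also have "\<dots> = (\<Sum>e\<in>?S. cnj (lcoeff p e * L (mon e)))"
      by (rule sum.cong) (use L in \<open>auto simp: lcoeff_dagger monom_zw_eq abs_le_iff\<close>)
    finally show ?thesis by (simp add: truncated_def)
  qed
  show "0 < truncated N M L (p * dagger p)" if "lsupp p \<subseteq> box N M" "p \<noteq> 0" for p
    using that L by (simp add: truncated_eq lsupp_mult_dagger Pi_hat_eq)
qed

text \<open>The predicates agree for every \<open>p\<close>, so the \<open>THE\<close> terms behind
  \<open>phi\<close> and \<open>phit\<close> coincide without any appeal to existence or
  uniqueness.\<close>

lemma is_orthopoly_truncated:
  assumes "linear_functional N M L" "S \<subseteq> box N M"
  shows "is_orthopoly (truncated N M L) S e p \<longleftrightarrow> is_orthopoly L S e p"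
proof (cases "lsupp p \<subseteq> S")
  case True
  then have p: "lsupp p \<subseteq> box N M" using assms by simp
  have "inner_zw (truncated N M L) p (mon f) = inner_zw L p (mon f)" if "f \<in> S" for f
    using that p assms by (intro inner_zw_truncated) auto
  then show ?thesis
    using inner_zw_truncated[OF assms(1) p p] by (auto simp: is_orthopoly_def)
qed (simp add: is_orthopoly_def)

lemma Phi_truncated:
  assumes "linear_functional N M L" "0 \<le> n" "n \<le> N" "m \<le> M"
  shows "Phi (truncated N M L) n m = Phi L n m"
proof (rule eq_matI)
  fix i j assume "i < dim_row (Phi L n m)" "j < dim_col (Phi L n m)"
  moreover have "phi_exps n m (m - int i) \<subseteq> box N M"
    using assms by (auto simp: phi_exps_def)
  ultimately show "Phi (truncated N M L) n m $$ (i, j) = Phi L n m $$ (i, j)"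
    using assms by (simp add: Phi_index phi_eq is_orthopoly_truncated)
qed simp_all

lemma Phit_truncated:
  assumes "linear_functional N M L" "0 \<le> m" "n \<le> N" "m \<le> M"
  shows "Phit (truncated N M L) n m = Phit L n m"
proof (rule eq_matI)
  fix i j assume "i < dim_row (Phit L n m)" "j < dim_col (Phit L n m)"
  moreover have "phit_exps n m (n - int i) \<subseteq> box N M"
    using assms by (auto simp: phit_exps_def)
  ultimately show "Phit (truncated N M L) n m $$ (i, j) = Phit L n m $$ (i, j)"
    using assms by (simp add: Phit_index phit_eq is_orthopoly_truncated)
qed simp_all

lemma mat_inner_truncated:
  assumes "linear_functional N M L" "supp_in X (box N M)" "supp_in Y (box N M)" "dim_col X = 1" "dim_col Y = 1"
  shows "mat_inner (truncated N M L) X Y = mat_inner L X Y"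
  by (rule eq_matI) (use assms in \<open>simp_all add: mat_inner_index supp_in_def inner_zw_truncated\<close>)

section \<open>Matrix inner products and orthogonality to sets of exponents\<close>

context hermitian_functional
begin

lemma mat_inner_diff_left:
  assumes "dim_col X = 1" "dim_col X' = 1" "dim_col Y = 1" "dim_row X = dim_row X'"
  shows "mat_inner L (X - X') Y = mat_inner L X Y - mat_inner L X' Y"
  by (rule eq_matI) (use assms in \<open>simp_all add: mat_inner_index ip_diff_left\<close>)

lemma mat_inner_diff_right:
  assumes "dim_col X = 1" "dim_col X' = 1" "dim_col Y = 1" "dim_row X = dim_row X'"
  shows "mat_inner L Y (X - X') = mat_inner L Y X - mat_inner L Y X'"
  by (rule eq_matI) (use assms in \<open>simp_all add: mat_inner_index ip_diff_right\<close>)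

lemma mat_inner_const_left:
  assumes "dim_col X = 1" "dim_col Y = 1" "dim_col C = dim_row X"
  shows "mat_inner L (const_mat C * X) Y = C * mat_inner L X Y"
proof (rule eq_matI)
  fix i j assume "i < dim_row (C * mat_inner L X Y)" "j < dim_col (C * mat_inner L X Y)"
  then have ij: "i < dim_row C" "j < dim_row Y" by simp_all
  then have "mat_inner L (const_mat C * X) Y $$ (i, j) = ip ((const_mat C * X) $$ (i, 0)) (Y $$ (j, 0))"
    using assms by (subst mat_inner_index) simp_all
  also have "\<dots> = (\<Sum>k<dim_row X. C $$ (i, k) * mat_inner L X Y $$ (k, j))"
    using assms ij by (simp only: const_mat_mult_index ip_sum_left ip_const_left) (simp add: mat_inner_index)
  also have "\<dots> = (C * mat_inner L X Y) $$ (i, j)"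
    using assms ij by (simp add: scalar_prod_def lessThan_atLeast0)
  finally show "mat_inner L (const_mat C * X) Y $$ (i, j) = (C * mat_inner L X Y) $$ (i, j)" .
qed (use assms in simp_all)

lemma mat_inner_commute:
  assumes "dim_col X = 1" "dim_col Y = 1"
  shows "mat_inner L Y X = map_mat cnj (transpose_mat (mat_inner L X Y))"
  by (rule eq_matI) (use assms in \<open>simp_all add: mat_inner_index flip: ip_commute\<close>)

lemma mat_inner_const_right:
  assumes "dim_col X = 1" "dim_col Y = 1" "dim_col C = dim_row X"
  shows "mat_inner L Y (const_mat C * X) = mat_inner L Y X * map_mat cnj (transpose_mat C)"
proof (rule eq_matI)
  fix i j assume "i < dim_row (mat_inner L Y X * map_mat cnj (transpose_mat C))"
    "j < dim_col (mat_inner L Y X * map_mat cnj (transpose_mat C))"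
  then have ij: "i < dim_row Y" "j < dim_row C" by simp_all
  then have "mat_inner L Y (const_mat C * X) $$ (i, j) = ip (Y $$ (i, 0)) ((const_mat C * X) $$ (j, 0))"
    using assms by (subst mat_inner_index) simp_all
  also have "\<dots> = (\<Sum>k<dim_row X. mat_inner L Y X $$ (i, k) * cnj (C $$ (j, k)))"
    using assms ij by (simp only: const_mat_mult_index ip_sum_right ip_const_right) (simp add: mat_inner_index mult.commute)
  also have "\<dots> = (mat_inner L Y X * map_mat cnj (transpose_mat C)) $$ (i, j)"
    using assms ij by (simp add: scalar_prod_def lessThan_atLeast0)
  finally show "mat_inner L Y (const_mat C * X) $$ (i, j) =
      (mat_inner L Y X * map_mat cnj (transpose_mat C)) $$ (i, j)" .
qed (use assms in simp_all)

lemma mat_inner_smult_both: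
  assumes "dim_col X = 1" "dim_col Y = 1"
  shows "mat_inner L (mon e \<cdot>\<^sub>m X) (mon e \<cdot>\<^sub>m Y) = mat_inner L X Y"
  by (rule eq_matI) (use assms in \<open>simp_all add: mat_inner_index ip_mon_mult_both\<close>)

lemma mat_inner_rev_mat:
  assumes "dim_col X = 1" "dim_col Y = 1"
  shows "mat_inner L (rev_mat e X) (rev_mat e Y) = map_mat cnj (mat_inner L X Y)"
  by (rule eq_matI)
     (use assms in \<open>simp_all add: mat_inner_index rev_mat_def ip_reverse flip: ip_commute\<close>)

text \<open>The counterpart of \<open>supp_in\<close>: if one column satisfies \<open>perp\<close>
  and another satisfies \<open>supp_in\<close> for the same set, their inner product is zero.
  Orthogonality of columns thus reduces to inclusions of exponent sets.\<close>

definition perp :: "laurent mat \<Rightarrow> (int \<times> int) set \<Rightarrow> bool" where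
  "perp X S \<longleftrightarrow> (\<forall>i<dim_row X. \<forall>e\<in>S. ip (X $$ (i, 0)) (mon e) = 0)"

lemma perp_mono: "perp X S \<Longrightarrow> T \<subseteq> S \<Longrightarrow> perp X T"
  by (auto simp: perp_def)

lemma perp_diff:
  assumes "perp X S" "perp Y S" "dim_row X = dim_row Y" "dim_col X = 1" "dim_col Y = 1"
  shows "perp (X - Y) S"
  using assms by (auto simp: perp_def ip_diff_left)

lemma perp_const_mult:
  assumes "perp X S" "dim_col C = dim_row X" "dim_col X = 1"
  shows "perp (const_mat C * X) S"
  unfolding perp_def
proof (intro allI impI ballI)
  fix i e assume "i < dim_row (const_mat C * X)" and e: "e \<in> S"
  then have i: "i < dim_row C" by simp
  show "ip ((const_mat C * X) $$ (i, 0)) (mon e) = 0"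
    unfolding const_mat_mult_index[OF assms(2,3) i] using assms e
    by (simp add: ip_sum_left ip_const_left perp_def)
qed

lemma perp_smult:
  assumes "perp X S" "(\<lambda>f. f - e) ` T \<subseteq> S" "dim_col X = 1"
  shows "perp (mon e \<cdot>\<^sub>m X) T"
  using assms by (auto simp: perp_def ip_mon_mult mult_single image_subset_iff)

lemma perp_rev_mat:
  assumes "perp X S" "(\<lambda>f. e - f) ` T \<subseteq> S" "dim_col X = 1"
  shows "perp (rev_mat e X) T"
  unfolding perp_def
proof (intro allI impI ballI)
  fix i f assume "i < dim_row (rev_mat e X)" "f \<in> T"
  then have "ip (X $$ (i, 0)) (mon (e - f)) = 0"
    using assms by (auto simp: perp_def)
  \<comment> \<open>Once \<open>mon f\<close> is written as a reversal too, antiunitarity moves the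
    question to \<open>X\<close> and the exponent \<open>e - f\<close>.\<close>
  moreover have "mon f = mon e * dagger (mon (e - f))"
    by (simp add: mult_single)
  ultimately show "ip (rev_mat e X $$ (i, 0)) (mon f) = 0"
    using assms(3) \<open>i < dim_row (rev_mat e X)\<close>
    by (simp add: rev_mat_def ip_reverse ip_commute[of _ "mon (e - f)"] del: dagger_single)
qed

lemma mat_inner_perp:
  assumes "perp X S" "supp_in Y S" "dim_col X = 1" "dim_col Y = 1"
  shows "mat_inner L X Y = 0\<^sub>m (dim_row X) (dim_row Y)"
proof (rule eq_matI)
  fix i j assume "i < dim_row (0\<^sub>m (dim_row X) (dim_row Y))" "j < dim_col (0\<^sub>m (dim_row X) (dim_row Y))"
  then have ij: "i < dim_row X" "j < dim_row Y" by simp_all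
  have "ip (X $$ (i, 0)) (Y $$ (j, 0)) = 0"
    by (rule ip_eq_0_supp[of S]) (use assms ij in \<open>simp_all add: perp_def supp_in_def\<close>)
  then show "mat_inner L X Y $$ (i, j) = 0\<^sub>m (dim_row X) (dim_row Y) $$ (i, j)"
    using assms ij by (simp add: mat_inner_index)
qed simp_all

end

section \<open>Orthonormality and completeness of \<open>Phi\<close> and \<open>Phit\<close>\<close>

context positive_functional
begin

text \<open>Each entry is orthogonal to itself, so positivity kills it. Both expansions end with
  this argument, applied to their defect.\<close>

lemma perp_supp_eq_0:
  assumes "supp_in V S" "perp V S" "S \<subseteq> box N M" "dim_col V = 1"
  shows "V = 0\<^sub>m (dim_row V) 1"
proof (rule eq_matI)
  fix i j assume "i < dim_row (0\<^sub>m (dim_row V) 1)" "j < dim_col (0\<^sub>m (dim_row V) 1)"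
  then have ij: "i < dim_row V" "j = 0" by simp_all
  have "V $$ (i, 0) = 0"
    by (rule orthogonal_self_eq_0[of _ S]) (use assms ij in \<open>simp_all add: perp_def supp_in_def\<close>)
  then show "V $$ (i, j) = 0\<^sub>m (dim_row V) 1 $$ (i, j)"
    using ij by simp
qed (use assms in simp_all)

lemma supp_in_Phi: "0 \<le> n \<Longrightarrow> n \<le> N \<Longrightarrow> m \<le> M \<Longrightarrow> supp_in (Phi L n m) (box n m)"
  unfolding supp_in_def
proof (intro allI impI)
  fix r assume *: "0 \<le> n" "n \<le> N" "m \<le> M" "r < dim_row (Phi L n m)"
  then have "lsupp (Phi L n m $$ (r, 0)) \<subseteq> phi_exps n m (m - int r)"
    using is_orthopoly_phi[of n m "m - int r"] by (simp add: Phi_index is_orthopoly_def)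
  also have "\<dots> \<subseteq> box n m"
    using * by (auto simp: phi_exps_def)
  finally show "lsupp (Phi L n m $$ (r, 0)) \<subseteq> box n m" .
qed

lemma supp_in_Phit: "0 \<le> m \<Longrightarrow> n \<le> N \<Longrightarrow> m \<le> M \<Longrightarrow> supp_in (Phit L n m) (box n m)"
  unfolding supp_in_def
proof (intro allI impI)
  fix r assume *: "0 \<le> m" "n \<le> N" "m \<le> M" "r < dim_row (Phit L n m)"
  then have "lsupp (Phit L n m $$ (r, 0)) \<subseteq> phit_exps n m (n - int r)"
    using is_orthopoly_phit[of m n "n - int r"] by (simp add: Phit_index is_orthopoly_def)
  also have "\<dots> \<subseteq> box n m"
    using * by (auto simp: phit_exps_def)
  finally show "lsupp (Phit L n m $$ (r, 0)) \<subseteq> box n m" .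
qed

lemma perp_Phi: "0 \<le> n \<Longrightarrow> n \<le> N \<Longrightarrow> m \<le> M \<Longrightarrow> perp (Phi L n m) (box (n - 1) m)"
  unfolding perp_def
proof (intro allI impI ballI)
  fix r e assume *: "0 \<le> n" "n \<le> N" "m \<le> M" "r < dim_row (Phi L n m)" "e \<in> box (n - 1) m"
  then have "e \<in> phi_exps n m (m - int r) - {(n, m - int r)}"
    by (auto simp: phi_exps_def)
  then show "ip (Phi L n m $$ (r, 0)) (mon e) = 0"
    using * is_orthopoly_phi[of n m "m - int r"] by (simp add: Phi_index is_orthopoly_def)
qed

lemma perp_Phit: "0 \<le> m \<Longrightarrow> n \<le> N \<Longrightarrow> m \<le> M \<Longrightarrow> perp (Phit L n m) (box n (m - 1))"
  unfolding perp_def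
proof (intro allI impI ballI)
  fix r e assume *: "0 \<le> m" "n \<le> N" "m \<le> M" "r < dim_row (Phit L n m)" "e \<in> box n (m - 1)"
  then have "e \<in> phit_exps n m (n - int r) - {(n - int r, m)}"
    by (auto simp: phit_exps_def)
  then show "ip (Phit L n m $$ (r, 0)) (mon e) = 0"
    using * is_orthopoly_phit[of m n "n - int r"] by (simp add: Phit_index is_orthopoly_def)
qed

lemma is_orthopoly_orthogonal:
  assumes p: "is_orthopoly L S e p" and q: "is_orthopoly L T f q" and sub: "T \<subseteq> S - {e}"
  shows "ip p q = 0" "ip q p = 0"
proof -
  show "ip p q = 0"
    by (rule ip_eq_0_supp[of T]) (use p q sub in \<open>auto simp: is_orthopoly_def\<close>)
  then show "ip q p = 0" using ip_commute[of q p] by simp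
qed

lemma ip_phi_phi:
  assumes "0 \<le> n" "n \<le> N" "m \<le> M" "0 \<le> l" "l \<le> m" "0 \<le> k" "k \<le> m"
  shows "ip (phi L n m l) (phi L n m k) = (if l = k then 1 else 0)"
proof -
  \<comment> \<open>The exponent sets grow with the index, and a smaller one omits the leading
    exponent of a larger one. Of two distinct polynomials, the one with the higher index is
    therefore orthogonal to all monomials of the other.\<close>
  have less_exps: "phi_exps n m i \<subseteq> phi_exps n m j - {(n, j)}" if "i < j" for i j
    using that by (auto simp: phi_exps_def)
  have op: "is_orthopoly L (phi_exps n m l) (n, l) (phi L n m l)"
    "is_orthopoly L (phi_exps n m k) (n, k) (phi L n m k)"
    using assms by (simp_all add: is_orthopoly_phi)
  show ?thesis
  proof (cases l k rule: linorder_cases)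
    case less
    then show ?thesis using is_orthopoly_orthogonal(2)[OF op(2,1) less_exps] by simp
  next
    case equal
    then show ?thesis using op(1) by (simp add: is_orthopoly_def)
  next
    case greater
    then show ?thesis using is_orthopoly_orthogonal(1)[OF op(1,2) less_exps] by simp
  qed
qed

lemma ip_phit_phit:
  assumes "0 \<le> m" "n \<le> N" "m \<le> M" "0 \<le> l" "l \<le> n" "0 \<le> k" "k \<le> n"
  shows "ip (phit L n m l) (phit L n m k) = (if l = k then 1 else 0)"
proof -
  have less_exps: "phit_exps n m i \<subseteq> phit_exps n m j - {(j, m)}" if "i < j" for i j
    using that by (auto simp: phit_exps_def)
  have op: "is_orthopoly L (phit_exps n m l) (l, m) (phit L n m l)"
    "is_orthopoly L (phit_exps n m k) (k, m) (phit L n m k)"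
    using assms by (simp_all add: is_orthopoly_phit)
  show ?thesis
  proof (cases l k rule: linorder_cases)
    case less
    then show ?thesis using is_orthopoly_orthogonal(2)[OF op(2,1) less_exps] by simp
  next
    case equal
    then show ?thesis using op(1) by (simp add: is_orthopoly_def)
  next
    case greater
    then show ?thesis using is_orthopoly_orthogonal(1)[OF op(1,2) less_exps] by simp
  qed
qed

lemma mat_inner_Phi_Phi:
  assumes "0 \<le> n" "n \<le> N" "m \<le> M"
  shows "mat_inner L (Phi L n m) (Phi L n m) = 1\<^sub>m (nat (m + 1))"
  by (rule eq_matI) (use assms in \<open>auto simp: mat_inner_index Phi_index ip_phi_phi\<close>)

lemma mat_inner_Phit_Phit:
  assumes "0 \<le> m" "n \<le> N" "m \<le> M"
  shows "mat_inner L (Phit L n m) (Phit L n m) = 1\<^sub>m (nat (n + 1))"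
  by (rule eq_matI) (use assms in \<open>auto simp: mat_inner_index Phit_index ip_phit_phit\<close>)

text \<open>
  Completeness of the orthonormal system: orthogonality extends to the next column of monomials one
  monomial at a time.
\<close>
lemma perp_extend_Phi:
  assumes V: "perp V (box (n - 1) m)" "dim_col V = 1"
    and 0: "mat_inner L V (Phi L n m) = 0\<^sub>m (dim_row V) (nat (m + 1))"
    and nm: "0 \<le> n" "n \<le> N" "m \<le> M"
  shows "perp V (box n m)"
proof -
  have "\<forall>e\<in>box n m. ip (V $$ (i, 0)) (mon e) = 0" if i: "i < dim_row V" for i
  proof -
    have orth: "ip (V $$ (i, 0)) (phi L n m l) = 0" if "0 \<le> l" "l \<le> m" for l
    proof -
      have "mat_inner L V (Phi L n m) $$ (i, nat (m - l)) = 0"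
        unfolding 0 using that i by simp
      then show ?thesis using that i V by (simp add: mat_inner_index Phi_index)
    qed
    have col: "ip (V $$ (i, 0)) (mon (n, int l)) = 0" if "int l \<le> m" for l
      using that
    proof (induction l rule: less_induct)
      case (less l)
      show ?case
      proof (rule is_orthopoly_complete[OF is_orthopoly_phi])
        show "ip (V $$ (i, 0)) (mon f) = 0" if f: "f \<in> phi_exps n m (int l) - {(n, int l)}" for f
        proof (cases "fst f = n")
          case True
          then have "f = (n, int (nat (snd f)))" "nat (snd f) < l"
            using f by (auto simp: phi_exps_def)
          then show ?thesis using less.IH[of "nat (snd f)"] less.prems by (simp split: if_splits)
        next
          case False
          then have "f \<in> box (n - 1) m" using f by (auto simp: phi_exps_def)
          then show ?thesis using V i unfolding perp_def by blast
        qed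
      qed (use nm less.prems orth in auto)
    qed
    show ?thesis
    proof
      fix e assume e: "e \<in> box n m"
      show "ip (V $$ (i, 0)) (mon e) = 0"
      proof (cases "fst e = n")
        case True
        then show ?thesis using col[of "nat (snd e)"] e by auto
      next
        case False
        then have "e \<in> box (n - 1) m" using e by auto
        then show ?thesis using V i unfolding perp_def by blast
      qed
    qed
  qed
  then show ?thesis by (simp add: perp_def)
qed

lemma perp_extend_Phit:
  assumes V: "perp V (box n (m - 1))" "dim_col V = 1"
    and 0: "mat_inner L V (Phit L n m) = 0\<^sub>m (dim_row V) (nat (n + 1))"
    and nm: "0 \<le> m" "n \<le> N" "m \<le> M"
  shows "perp V (box n m)"
proof -
  have "\<forall>e\<in>box n m. ip (V $$ (i, 0)) (mon e) = 0" if i: "i < dim_row V" for i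
  proof -
    have orth: "ip (V $$ (i, 0)) (phit L n m l) = 0" if "0 \<le> l" "l \<le> n" for l
    proof -
      have "mat_inner L V (Phit L n m) $$ (i, nat (n - l)) = 0"
        unfolding 0 using that i by simp
      then show ?thesis using that i V by (simp add: mat_inner_index Phit_index)
    qed
    have row: "ip (V $$ (i, 0)) (mon (int l, m)) = 0" if "int l \<le> n" for l
      using that
    proof (induction l rule: less_induct)
      case (less l)
      show ?case
      proof (rule is_orthopoly_complete[OF is_orthopoly_phit])
        show "ip (V $$ (i, 0)) (mon f) = 0" if f: "f \<in> phit_exps n m (int l) - {(int l, m)}" for f
        proof (cases "snd f = m")
          case True
          then have "f = (int (nat (fst f)), m)" "nat (fst f) < l"
            using f by (auto simp: phit_exps_def)
          then show ?thesis using less.IH[of "nat (fst f)"] less.prems by (simp split: if_splits)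
        next
          case False
          then have "f \<in> box n (m - 1)" using f less.prems by (auto simp: phit_exps_def)
          then show ?thesis using V i unfolding perp_def by blast
        qed
      qed (use nm less.prems orth in auto)
    qed
    show ?thesis
    proof
      fix e assume e: "e \<in> box n m"
      show "ip (V $$ (i, 0)) (mon e) = 0"
      proof (cases "snd e = m")
        case True
        then show ?thesis using row[of "nat (fst e)"] e by auto
      next
        case False
        then have "e \<in> box n (m - 1)" using e by auto
        then show ?thesis using V i unfolding perp_def by blast
      qed
    qed
  qed
  then show ?thesis by (simp add: perp_def)
qed

end

section \<open>Shifts and reversals of linear combinations\<close>

lemma lcoeff_mon_mult: "lcoeff (mon e * p) f = lcoeff p (f - e)"
  by (rule additive_ext_single[where f = "\<lambda>p. lcoeff (mon e * p) f"])
     (auto simp: distrib_left lookup_add mult_single lookup_single when_def)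

lemma lsupp_mon_mult_subset: "lsupp p \<subseteq> S \<Longrightarrow> lsupp (mon e * p) \<subseteq> (+) e ` S"
  using lsupp_mon_mult[of e p] by blast

lemma smult_const_mat_mult:
  assumes "dim_col X = 1" "dim_col C = dim_row X"
  shows "mon e \<cdot>\<^sub>m (const_mat C * X) = const_mat C * (mon e \<cdot>\<^sub>m X)"
  using assms by (intro mult_smult_distrib[symmetric, of _ "dim_row C" "dim_row X" _ 1]) auto

lemma rev_mat_diff:
  assumes "dim_row X = dim_row Y" "dim_col X = dim_col Y"
  shows "rev_mat e (X - Y) = rev_mat e X - rev_mat e Y"
  by (rule eq_matI) (use assms in \<open>simp_all add: rev_mat_def right_diff_distrib\<close>)

lemma rev_mat_const_mult:
  assumes "dim_col X = 1" "dim_col C = dim_row X"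
  shows "rev_mat e (const_mat C * X) = const_mat (map_mat cnj C) * rev_mat e X"
proof (rule eq_matI)
  fix i j assume "i < dim_row (const_mat (map_mat cnj C) * rev_mat e X)"
    "j < dim_col (const_mat (map_mat cnj C) * rev_mat e X)"
  then have ij: "i < dim_row C" "j = 0" using assms by simp_all
  have "rev_mat e (const_mat C * X) $$ (i, 0) = mon e * dagger ((const_mat C * X) $$ (i, 0))"
    using ij assms by (simp add: rev_mat_def)
  also have "\<dots> = (\<Sum>j<dim_row X. const (cnj (C $$ (i, j))) * (mon e * dagger (X $$ (j, 0))))"
    using ij assms by (simp only: const_mat_mult_index) (simp add: dagger_sum sum_distrib_left ac_simps)
  also have "\<dots> = (const_mat (map_mat cnj C) * rev_mat e X) $$ (i, 0)"
    using ij assms by (simp only: const_mat_mult_index dim_rev_mat index_map_mat) (simp add: rev_mat_def)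
  finally show "rev_mat e (const_mat C * X) $$ (i, j) = (const_mat (map_mat cnj C) * rev_mat e X) $$ (i, j)"
    using ij by simp
qed (use assms in simp_all)

lemma rev_mat_smult: "rev_mat e (mon f \<cdot>\<^sub>m X) = rev_mat (e - f) X"
  by (rule eq_matI) (simp_all add: rev_mat_def mult_single flip: mult.assoc)

lemma rev_mat_rev_mat: "rev_mat e (rev_mat f X) = mon (e - f) \<cdot>\<^sub>m X"
  by (rule eq_matI) (simp_all add: rev_mat_def mult_single flip: mult.assoc)

section \<open>The two expansions and the invertibility of \<open>Amat_t\<close>\<close>

context positive_functional
begin

text \<open>Reversal about \<open>(n, m)\<close> carries the w-exponents 1 to m to the range 0 to m
  - 1, where completeness of \<open>Phit\<close> applies; a second reversal restores
  \<open>V\<close>. Orthogonality is thus extended downwards, to the w-exponent 0.\<close>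

lemma perp_extend_Phit_rev:
  assumes V: "perp V ({0..n} \<times> {1..m})" "dim_col V = 1"
    and 0: "mat_inner L V (rev_mat (n, m) (Phit L n m)) = 0\<^sub>m (dim_row V) (nat (n + 1))"
    and nm: "0 \<le> m" "n \<le> N" "m \<le> M"
  shows "perp V (box n m)"
proof -
  have "perp (rev_mat (n, m) V) (box n m)"
  proof (rule perp_extend_Phit)
    show "perp (rev_mat (n, m) V) (box n (m - 1))"
      by (rule perp_rev_mat[OF V(1)]) (use V in auto)
    have "mat_inner L (rev_mat (n, m) V) (rev_mat (n, m) (rev_mat (n, m) (Phit L n m))) =
        map_mat cnj (0\<^sub>m (dim_row V) (nat (n + 1)))"
      using V by (simp only: mat_inner_rev_mat dim_rev_mat dim_Phit 0)
    moreover have "mon 0 \<cdot>\<^sub>m Phit L n m = Phit L n m"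
      by (rule eq_matI) simp_all
    ultimately show "mat_inner L (rev_mat (n, m) V) (Phit L n m) =
        0\<^sub>m (dim_row (rev_mat (n, m) V)) (nat (n + 1))"
      by (simp add: rev_mat_rev_mat) (auto intro!: eq_matI)
  qed (use V nm in simp_all)
  then have "perp (rev_mat (n, m) (rev_mat (n, m) V)) (box n m)"
    by (rule perp_rev_mat) (use V in auto)
  moreover have "mon 0 \<cdot>\<^sub>m V = V"
    by (rule eq_matI) simp_all
  ultimately show ?thesis
    by (simp add: rev_mat_rev_mat)
qed

text \<open>\<open>Gamma_mat\<close> and \<open>Kmat\<close> are the Fourier coefficients of
  \<open>Phi L n (m - 1)\<close> along \<open>Phi L n m\<close> and \<open>Phit L (n - 1) m\<close>.
  The case \<open>m = 0\<close>, where \<open>Phi L n (- 1)\<close> is empty and there are no rows,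
  is included because the first relation refers to it when its own \<open>m\<close> is 1.\<close>

lemma Gamma_mat_Phi:
  assumes "1 \<le> n" "n \<le> N" "0 \<le> m" "m \<le> M"
  shows "const_mat (Gamma_mat L n m) * Phi L n m =
    Phi L n (m - 1) - const_mat (Kmat L n m) * Phit L (n - 1) m"
proof -
  let ?X = "Phi L n m" and ?X' = "Phi L n (m - 1)" and ?Y = "Phit L (n - 1) m"
  let ?G = "Gamma_mat L n m" and ?K = "Kmat L n m"
  define V where "V = ?X' - const_mat ?K * ?Y - const_mat ?G * ?X"
  have dims [simp]: "dim_row ?G = nat m" "dim_col ?G = nat (m + 1)" "dim_row ?K = nat m" "dim_col ?K = nat n"
    by (simp_all add: Gamma_mat_def Kmat_def)
  have dimV [simp]: "dim_row V = nat m" "dim_col V = 1"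
    by (simp_all add: V_def)
  \<comment> \<open>\<open>?Y\<close> is supported exactly in the rectangle to which
    \<open>?X\<close> is orthogonal, so the two orthonormal columns do not interfere.\<close>
  have XY: "mat_inner L ?X ?Y = 0\<^sub>m (nat (m + 1)) (nat n)"
    using mat_inner_perp[of ?X "box (n - 1) m" ?Y] perp_Phi supp_in_Phit assms by simp
  then have YX: "mat_inner L ?Y ?X = 0\<^sub>m (nat n) (nat (m + 1))"
    by (subst mat_inner_commute) (auto intro!: eq_matI)
  have XX: "mat_inner L ?X ?X = 1\<^sub>m (nat (m + 1))" and YY: "mat_inner L ?Y ?Y = 1\<^sub>m (nat n)"
    using mat_inner_Phi_Phi mat_inner_Phit_Phit[of m "n - 1"] assms by simp_all
  have carr [simp]: "?G \<in> carrier_mat (nat m) (nat (m + 1))" "?K \<in> carrier_mat (nat m) (nat n)"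
    by (simp_all add: carrier_matI)
  have VX: "mat_inner L V ?X = 0\<^sub>m (nat m) (nat (m + 1))"
    unfolding V_def
    by (simp add: mat_inner_diff_left mat_inner_const_left XX YX right_mult_one_mat[OF carr(1)] flip: Gamma_mat_def)
       (auto intro!: eq_matI simp: right_mult_zero_mat[OF carr(2)])
  have VY: "mat_inner L V ?Y = 0\<^sub>m (nat m) (nat n)"
    unfolding V_def
    by (simp add: mat_inner_diff_left mat_inner_const_left YY XY right_mult_one_mat[OF carr(2)] flip: Kmat_def)
       (auto intro!: eq_matI simp: right_mult_zero_mat[OF carr(1)])
  have "V = 0\<^sub>m (dim_row V) 1"
  proof (rule perp_supp_eq_0)
    have "supp_in ?X' (box n m)" "supp_in ?Y (box n m)" "supp_in ?X (box n m)"
      by (rule supp_in_mono[OF supp_in_Phi] supp_in_mono[OF supp_in_Phit]; use assms in force)+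
    then show "supp_in V (box n m)"
      unfolding V_def by (intro supp_in_diff supp_in_const_mult) simp_all
    have "perp ?X' (box (n - 1) (m - 1))" "perp ?Y (box (n - 1) (m - 1))" "perp ?X (box (n - 1) (m - 1))"
      by (rule perp_mono[OF perp_Phi] perp_mono[OF perp_Phit]; use assms in force)+
    then have "perp V (box (n - 1) (m - 1))"
      unfolding V_def by (intro perp_diff perp_const_mult) simp_all
    \<comment> \<open>First the w-exponent \<open>m\<close> is added by means of \<open>VY\<close>,
      then the z-exponent \<open>n\<close> by means of \<open>VX\<close>. The order matters: the
      second extension presupposes orthogonality to all of \<open>box (n - 1) m\<close>.\<close>
    then have "perp V (box (n - 1) m)"
      by (rule perp_extend_Phit) (use VY assms in simp_all)
    then show "perp V (box n m)"
      by (rule perp_extend_Phi) (use VX assms in simp_all)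
  qed (use assms in auto)
  then have V0: "V $$ (i, 0) = 0" if "i < nat m" for i
    by (metis dimV(1) index_zero_mat(1) less_one that)
  show ?thesis
  proof (rule eq_matI)
    fix i j
    assume "i < dim_row (?X' - const_mat ?K * ?Y)" "j < dim_col (?X' - const_mat ?K * ?Y)"
    then have "i < nat m" "j = 0" by simp_all
    with V0[of i] show "(const_mat ?G * ?X) $$ (i, j) = (?X' - const_mat ?K * ?Y) $$ (i, j)"
      by (simp add: V_def del: index_mult_mat(1) index_map_mat(1)) 
  qed simp_all
qed

text \<open>\<open>Phit L n (m - 1)\<close> is orthogonal to the w-exponents 0 to m - 2.
  Multiplication by w and reversal about \<open>(n, m - 1)\<close> both turn this range into 1 to m
  - 1, to which \<open>Phit L n m\<close> is orthogonal as well. Of the two missing exponents, 0 is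
  supplied by the reversed column and \<open>m\<close> by \<open>Phit L n m\<close>.\<close>

lemma Amat_t_Phit:
  assumes "0 \<le> n" "n \<le> N" "1 \<le> m" "m \<le> M"
  shows "const_mat (Amat_t L n m) * Phit L n m =
    mon (0, 1) \<cdot>\<^sub>m Phit L n (m - 1) -
    const_mat (Ehat_t L n m) * rev_mat (n, m - 1) (Phit L n (m - 1))"
proof -
  let ?Y = "Phit L n m" and ?W = "mon (0, 1) \<cdot>\<^sub>m Phit L n (m - 1)" and
    ?R = "rev_mat (n, m - 1) (Phit L n (m - 1))"
  let ?A = "Amat_t L n m" and ?E = "Ehat_t L n m"
  let ?d = "nat (n + 1)"
  define V where "V = ?W - const_mat ?E * ?R - const_mat ?A * ?Y"
  have A: "?A = mat_inner L ?W ?Y" and E: "?E = mat_inner L ?W ?R"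
    by (simp_all add: Amat_t_def Ehat_t_def transpose_Phit_rev monom_zw_eq)
  have dims [simp]: "dim_row ?A = ?d" "dim_col ?A = ?d" "dim_row ?E = ?d" "dim_col ?E = ?d"
    by (simp_all add: A E)
  have dimV [simp]: "dim_row V = ?d" "dim_col V = 1"
    by (simp_all add: V_def)
  have suppR: "supp_in ?R (box n (m - 1))"
    by (rule supp_in_rev_mat[OF supp_in_Phit]) (use assms in auto)
  have YR: "mat_inner L ?Y ?R = 0\<^sub>m ?d ?d"
    using mat_inner_perp[of ?Y "box n (m - 1)" ?R] perp_Phit suppR assms by simp
  then have RY: "mat_inner L ?R ?Y = 0\<^sub>m ?d ?d"
    by (subst mat_inner_commute) (auto intro!: eq_matI)
  have YY: "mat_inner L ?Y ?Y = 1\<^sub>m ?d"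
    using mat_inner_Phit_Phit assms by simp
  have RR: "mat_inner L ?R ?R = 1\<^sub>m ?d"
    using mat_inner_Phit_Phit[of "m - 1" n] assms
    by (simp add: mat_inner_rev_mat) (auto intro!: eq_matI)
  have carr: "?A \<in> carrier_mat ?d ?d" "?E \<in> carrier_mat ?d ?d"
    by (simp_all add: carrier_matI)
  have VY: "mat_inner L V ?Y = 0\<^sub>m ?d ?d"
    unfolding V_def
    by (simp add: mat_inner_diff_left mat_inner_const_left YY RY right_mult_one_mat[OF carr(1)] flip: A)
       (auto intro!: eq_matI simp: right_mult_zero_mat[OF carr(2)])
  have VR: "mat_inner L V ?R = 0\<^sub>m ?d ?d"
    unfolding V_def
    by (simp add: mat_inner_diff_left mat_inner_const_left RR YR right_mult_one_mat[OF carr(2)] flip: E)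
       (auto intro!: eq_matI simp: right_mult_zero_mat[OF carr(1)])
  have "V = 0\<^sub>m (dim_row V) 1"
  proof (rule perp_supp_eq_0)
    have "supp_in ?W (box n m)"
      by (rule supp_in_smult[OF supp_in_Phit]) (use assms in auto)
    moreover have "supp_in ?R (box n m)"
      by (rule supp_in_mono[OF suppR]) auto
    moreover have "supp_in ?Y (box n m)"
      by (rule supp_in_Phit) (use assms in auto)
    ultimately show "supp_in V (box n m)"
      unfolding V_def by (intro supp_in_diff supp_in_const_mult) simp_all
    let ?S = "{0..n} \<times> {1..m - 1}"
    have "perp ?W ?S"
      by (rule perp_smult[OF perp_Phit]) (use assms in auto)
    moreover have "perp ?R ?S"
      by (rule perp_rev_mat[OF perp_Phit]) (use assms in auto)
    moreover have "perp ?Y ?S"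
      by (rule perp_mono[OF perp_Phit]) (use assms in auto)
    ultimately have "perp V ?S"
      unfolding V_def by (intro perp_diff perp_const_mult) simp_all
    then have "perp V (box n (m - 1))"
      by (rule perp_extend_Phit_rev) (use VR assms in simp_all)
    then show "perp V (box n m)"
      by (rule perp_extend_Phit) (use VY assms in simp_all)
  qed (use assms in auto)
  then have V0: "V $$ (i, 0) = 0" if "i < ?d" for i
    by (metis dimV(1) index_zero_mat(1) less_one that)
  show ?thesis
  proof (rule eq_matI)
    fix i j
    assume "i < dim_row (?W - const_mat ?E * ?R)" "j < dim_col (?W - const_mat ?E * ?R)"
    then have "i < ?d" "j = 0" by simp_all
    with V0[of i] show "(const_mat ?A * ?Y) $$ (i, j) = (?W - const_mat ?E * ?R) $$ (i, j)"
      by (simp add: V_def del: index_mult_mat(1) index_map_mat(1))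
  qed simp_all
qed

text \<open>
  If the inner product vanished, the orthogonality of \<open>phit L n m l\<close> would extend to its leading monomial
  and the polynomial would be orthogonal to itself.
\<close>
lemma Amat_t_diag_nonzero:
  assumes "0 \<le> n" "n \<le> N" "1 \<le> m" "m \<le> M" "0 \<le> l" "l \<le> n"
  shows "ip (mon (0, 1) * phit L n (m - 1) l) (phit L n m l) \<noteq> 0"
proof
  let ?p = "phit L n m l" and ?q = "mon (0, 1) * phit L n (m - 1) l"
  let ?S = "phit_exps n m l"
  assume 0: "ip ?q ?p = 0"
  have p: "is_orthopoly L ?S (l, m) ?p"
    and q: "is_orthopoly L (phit_exps n (m - 1) l) (l, m - 1) (phit L n (m - 1) l)"
    using assms by (simp_all add: is_orthopoly_phit)
  have "lcoeff ?q (l, m) = lcoeff (phit L n (m - 1) l) (l, m - 1)"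
    by (simp add: lcoeff_mon_mult)
  then have c: "lcoeff ?q (l, m) \<noteq> 0"
    using q by (auto simp: is_orthopoly_def)
  define r where "r = ?q - const (lcoeff ?q (l, m)) * mon (l, m)"
  have "lsupp ?q \<subseteq> ?S"
  proof -
    have "lsupp ?q \<subseteq> (+) (0, 1) ` phit_exps n (m - 1) l"
      by (rule lsupp_mon_mult_subset) (use q in \<open>simp add: is_orthopoly_def\<close>)
    also have "\<dots> \<subseteq> ?S" using assms by (auto simp: phit_exps_def)
    finally show ?thesis .
  qed
  then have "lsupp r \<subseteq> ?S - {(l, m)}"
    unfolding r_def
    by (intro lsupp_remove lsupp_diff_subset lsupp_const_subset)
       (use assms in \<open>auto simp: lookup_minus phit_exps_def\<close>)
  then have "ip ?p r = 0"
    by (rule ip_eq_0_supp[rotated]) (use p in \<open>auto simp: is_orthopoly_def\<close>)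
  moreover have "ip ?p ?q = 0"
    using 0 ip_commute[of ?p ?q] by simp
  ultimately have "ip ?p (mon (l, m)) = 0"
    using c by (simp add: r_def ip_diff_right ip_const_right)
  then have "ip ?p (mon e) = 0" if "e \<in> ?S" for e
    using p that by (cases "e = (l, m)") (auto simp: is_orthopoly_def)
  then have "ip ?p ?p = 0"
    using p ip_eq_0_supp[of ?S ?p ?p] by (simp add: is_orthopoly_def)
  then show False
    using p by (simp add: is_orthopoly_def)
qed

text \<open>Entries are listed by descending index, so below the diagonal w times the lower
  polynomial has only exponents to which the higher one is orthogonal. The matrix is thus upper
  triangular with nonzero diagonal, and \<open>mat_inv\<close> is its genuine inverse.\<close>

lemma mat_inv_Amat_t:
  assumes "0 \<le> n" "n \<le> N" "1 \<le> m" "m \<le> M"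
  shows "Amat_t L n m * mat_inv (Amat_t L n m) = 1\<^sub>m (nat (n + 1))"
    "mat_inv (Amat_t L n m) * Amat_t L n m = 1\<^sub>m (nat (n + 1))"
    "mat_inv (Amat_t L n m) \<in> carrier_mat (nat (n + 1)) (nat (n + 1))"
proof -
  let ?A = "Amat_t L n m" and ?d = "nat (n + 1)"
  have A: "?A \<in> carrier_mat ?d ?d"
    by (simp add: Amat_t_def carrier_matI)
  have idx: "?A $$ (i, j) = ip (mon (0, 1) * phit L n (m - 1) (n - int i)) (phit L n m (n - int j))"
    if "i < ?d" "j < ?d" for i j
    using that by (simp add: Amat_t_def mat_inner_index Phit_index monom_zw_eq)
  have "upper_triangular ?A"
  proof
    fix i j assume ij: "j < i" "i < dim_row ?A"
    with A have i: "i < ?d" by simp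
    let ?p = "phit L n m (n - int j)" and ?q = "phit L n (m - 1) (n - int i)"
    have p: "is_orthopoly L (phit_exps n m (n - int j)) (n - int j, m) ?p"
      and q: "is_orthopoly L (phit_exps n (m - 1) (n - int i)) (n - int i, m - 1) ?q"
      using assms i ij by (simp_all add: is_orthopoly_phit)
    have "lsupp (mon (0, 1) * ?q) \<subseteq> (+) (0, 1) ` phit_exps n (m - 1) (n - int i)"
      by (rule lsupp_mon_mult_subset) (use q in \<open>simp add: is_orthopoly_def\<close>)
    also have "\<dots> \<subseteq> phit_exps n m (n - int j) - {(n - int j, m)}"
      using assms ij by (auto simp: phit_exps_def)
    finally have "ip ?p (mon (0, 1) * ?q) = 0"
      by (rule ip_eq_0_supp[rotated]) (use p in \<open>auto simp: is_orthopoly_def\<close>)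
    then show "?A $$ (i, j) = 0"
      using ip_commute[of "mon (0, 1) * ?q" ?p] i ij by (simp add: idx)
  qed
  moreover have "0 \<notin> set (diag_mat ?A)"
    using A assms by (auto simp: diag_mat_def idx Amat_t_diag_nonzero)
  ultimately have "det ?A \<noteq> 0"
    using upper_triangular_imp_det_eq_0_iff[OF A] by simp
  then have "?A \<in> Units (ring_mat TYPE(complex) ?d ())"
    by (rule det_non_zero_imp_unit[OF A])
  then obtain B where "mat_inverse ?A = Some B"
    using mat_inverse(1)[OF A] by fastforce
  then show "?A * mat_inv ?A = 1\<^sub>m ?d" "mat_inv ?A * ?A = 1\<^sub>m ?d" "mat_inv ?A \<in> carrier_mat ?d ?d"
    using mat_inverse(2)[OF A, of B] by (simp_all add: mat_inv_def)
qed

text \<open>The \<open>dagger\<close> in the reversal and the one in the inner product undo each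
  other: an entry is \<open>L\<close> of a fixed monomial times the product of two entries of
  \<open>Phit L n (m - 1)\<close>, and products commute.\<close>

lemma transpose_Ehat_t: "transpose_mat (Ehat_t L n m) = Ehat_t L n m"
proof (rule eq_matI)
  fix i j assume "i < dim_row (Ehat_t L n m)" "j < dim_col (Ehat_t L n m)"
  then show "transpose_mat (Ehat_t L n m) $$ (i, j) = Ehat_t L n m $$ (i, j)"
    by (simp add: Ehat_t_def transpose_Phit_rev mat_inner_index rev_mat_def inner_zw_def ac_simps)
qed (simp_all add: Ehat_t_def transpose_Phit_rev)

end

section \<open>The first relation\<close>

context positive_functional
begin

lemma Gamma_mat_mult_K1mat:
  assumes "1 \<le> n" "n \<le> N" "1 \<le> m" "m \<le> M"
  shows "Gamma_mat L n (m - 1) * K1mat L n m * transpose_mat (Amat_t L (n - 1) m) =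
    K1mat L n (m - 1) - Kmat L n (m - 1) * Ehat_t L (n - 1) m"
proof -
  let ?X = "Phi L n (m - 1)" and ?X' = "Phi L n (m - 2)" and
    ?Y = "Phit L (n - 1) m" and ?Y' = "Phit L (n - 1) (m - 1)"
  let ?G = "Gamma_mat L n (m - 1)" and ?K = "Kmat L n (m - 1)"
  let ?A = "Amat_t L (n - 1) m" and ?E = "Ehat_t L (n - 1) m"
  let ?w = "mon (0, 1)"
  let ?R = "rev_mat (n - 1, m - 1) ?Y'"
  have dims [simp]: "dim_row ?G = nat (m - 1)" "dim_col ?G = nat m" "dim_row ?K = nat (m - 1)"
      "dim_col ?K = nat n" "dim_row ?A = nat n" "dim_col ?A = nat n" "dim_row ?E = nat n" "dim_col ?E = nat n"
    by (simp_all add: Gamma_mat_def Kmat_def Amat_t_def Ehat_t_def transpose_Phit_rev)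
  have carr: "?K \<in> carrier_mat (nat (m - 1)) (nat n)" "?E \<in> carrier_mat (nat n) (nat n)"
    by (simp_all add: carrier_matI)
  have "?w \<cdot>\<^sub>m (const_mat ?G * ?X) = ?w \<cdot>\<^sub>m (?X' - const_mat ?K * ?Y')"
    using Gamma_mat_Phi[of n "m - 1"] assms by simp
  also have "\<dots> = ?w \<cdot>\<^sub>m ?X' - ?w \<cdot>\<^sub>m (const_mat ?K * ?Y')"
    by (rule eq_matI) (simp_all add: right_diff_distrib)
  finally have 1: "const_mat ?G * (?w \<cdot>\<^sub>m ?X) = ?w \<cdot>\<^sub>m ?X' - const_mat ?K * (?w \<cdot>\<^sub>m ?Y')"
    by (simp add: smult_const_mat_mult)
  \<comment> \<open>Reversing about \<open>(n - 1, m)\<close>, one power of w above the reversal in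
    \<open>?R\<close>, exchanges the two columns on the right: w times \<open>?Y'\<close> becomes
    \<open>?R\<close>, and \<open>?R\<close> becomes w times \<open>?Y'\<close>.\<close>
  have "rev_mat (n - 1, m) (const_mat ?A * ?Y) =
      rev_mat (n - 1, m) (?w \<cdot>\<^sub>m ?Y' - const_mat ?E * ?R)"
    using Amat_t_Phit[of "n - 1" m] assms by simp
  then have 2: "const_mat (map_mat cnj ?A) * rev_mat (n - 1, m) ?Y =
      ?R - const_mat (map_mat cnj ?E) * (?w \<cdot>\<^sub>m ?Y')"
    by (simp add: rev_mat_const_mult rev_mat_diff rev_mat_smult rev_mat_rev_mat)
  \<comment> \<open>The conjugation from the reversal meets the adjoint from the second argument,
    and only a transpose is left.\<close>
  have cnj2: "map_mat cnj (transpose_mat (map_mat cnj B)) = transpose_mat B" for B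
    by (rule eq_matI) simp_all
  have YY: "mat_inner L (?w \<cdot>\<^sub>m ?Y') (?w \<cdot>\<^sub>m ?Y') = 1\<^sub>m (nat n)"
    using mat_inner_Phit_Phit[of "m - 1" "n - 1"] assms by (simp add: mat_inner_smult_both)
  have XY: "mat_inner L (?w \<cdot>\<^sub>m ?X') (?w \<cdot>\<^sub>m ?Y') = ?K"
    by (simp add: mat_inner_smult_both Kmat_def)
  have YR: "mat_inner L (?w \<cdot>\<^sub>m ?Y') ?R = ?E"
    by (simp add: Ehat_t_def transpose_Phit_rev monom_zw_eq)
  have XR: "mat_inner L (?w \<cdot>\<^sub>m ?X') ?R = K1mat L n (m - 1)"
    by (simp add: K1mat_def transpose_Phit_rev monom_zw_eq)
  have K1: "K1mat L n m = mat_inner L (?w \<cdot>\<^sub>m ?X) (rev_mat (n - 1, m) ?Y)"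
    by (simp add: K1mat_def transpose_Phit_rev monom_zw_eq)
  have "?G * K1mat L n m * transpose_mat ?A =
      mat_inner L (const_mat ?G * (?w \<cdot>\<^sub>m ?X)) (const_mat (map_mat cnj ?A) * rev_mat (n - 1, m) ?Y)"
    by (simp add: K1 mat_inner_const_left mat_inner_const_right cnj2)
  \<comment> \<open>The first bracket comes from pairing with \<open>?R\<close>, the second from
    pairing with w times \<open>?Y'\<close>. The latter vanishes since \<open>?X'\<close> minus its
    component along the orthonormal column \<open>?Y'\<close> is orthogonal to
    \<open>?Y'\<close>.\<close>
  also have "\<dots> = (K1mat L n (m - 1) - ?K * ?E) - (?K - ?K * 1\<^sub>m (nat n)) * ?E"
    unfolding 1 2
    by (simp add: mat_inner_diff_left mat_inner_diff_right mat_inner_const_left mat_inner_const_right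
        cnj2 transpose_Ehat_t XR XY YR YY)
  also have "\<dots> = K1mat L n (m - 1) - ?K * ?E"
    unfolding right_mult_one_mat[OF carr(1)] minus_r_inv_mat[OF carr(1)] left_mult_zero_mat[OF carr(2)]
    by (rule eq_matI) (simp_all add: K1mat_def transpose_Phit_rev)
  finally show ?thesis .
qed

lemma Gamma_mat_mult_K1mat_inv:
  assumes "1 \<le> n" "n \<le> N" "1 \<le> m" "m \<le> M"
  shows "Gamma_mat L n (m - 1) * K1mat L n m =
    K1mat L n (m - 1) * transpose_mat (mat_inv (Amat_t L (n - 1) m))
    - Kmat L n (m - 1) * Ehat_t L (n - 1) m * transpose_mat (mat_inv (Amat_t L (n - 1) m))"
proof -
  let ?G = "Gamma_mat L n (m - 1)" and ?K = "Kmat L n (m - 1)"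
    and ?A = "Amat_t L (n - 1) m" and ?E = "Ehat_t L (n - 1) m"
    and ?K1 = "K1mat L n m" and ?K1' = "K1mat L n (m - 1)"
  let ?B = "mat_inv ?A"
  note inv = mat_inv_Amat_t[of "n - 1" m]
  have carr: "?G \<in> carrier_mat (nat (m - 1)) (nat m)" "?K \<in> carrier_mat (nat (m - 1)) (nat n)"
      "?A \<in> carrier_mat (nat n) (nat n)" "?E \<in> carrier_mat (nat n) (nat n)"
      "?K1 \<in> carrier_mat (nat m) (nat n)" "?K1' \<in> carrier_mat (nat (m - 1)) (nat n)"
    by (simp_all add: Gamma_mat_def Kmat_def Amat_t_def Ehat_t_def K1mat_def transpose_Phit_rev carrier_matI)
  have B: "?B \<in> carrier_mat (nat n) (nat n)" and BA: "?B * ?A = 1\<^sub>m (nat n)"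
    using inv assms by simp_all
  have "transpose_mat ?A * transpose_mat ?B = 1\<^sub>m (nat n)"
    using BA by (metis transpose_mult[OF B carr(3)] transpose_one)
  then have "?G * ?K1 = ?G * ?K1 * (transpose_mat ?A * transpose_mat ?B)"
    using carr by (metis mult_carrier_mat right_mult_one_mat)
  also have "\<dots> = ?G * ?K1 * transpose_mat ?A * transpose_mat ?B"
    using carr B by (intro assoc_mult_mat[symmetric, of _ "nat (m - 1)" "nat n" _ "nat n" _ "nat n"]) auto
  also have "\<dots> = (?K1' - ?K * ?E) * transpose_mat ?B"
    using Gamma_mat_mult_K1mat assms by simp
  also have "\<dots> = ?K1' * transpose_mat ?B - ?K * ?E * transpose_mat ?B"
    using carr B by (intro minus_mult_distrib_mat[of _ "nat (m - 1)" "nat n" _ _ "nat n"]) auto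
  finally show ?thesis .
qed

end

section \<open>Interchange of z and w, and the second relation\<close>

lemma inner_zw_swap: "inner_zw (L \<circ> swap_zw) p q = inner_zw L (swap_zw p) (swap_zw q)"
  by (simp add: inner_zw_def dagger_swap)

lemma swap_const_mult: "swap_zw (const c * p) = const c * swap_zw p"
  by (simp add: zero_prod_def)

lemma swap_subset_swap: "prod.swap ` S \<subseteq> prod.swap ` T \<longleftrightarrow> S \<subseteq> T"
  by (rule inj_image_subset_iff) simp

lemma is_orthopoly_swap:
  assumes "is_orthopoly L S e p"
  shows "is_orthopoly (L \<circ> swap_zw) (prod.swap ` S) (prod.swap e) (swap_zw p)"
  using assms
  by (auto simp: is_orthopoly_def inner_zw_swap lsupp_swap lcoeff_swap swap_subset_swap simp del: o_apply)

lemma swap_phi_exps: "prod.swap ` phi_exps n m l = phit_exps m n l"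
  by (auto simp: phi_exps_def phit_exps_def image_Un product_swap)

lemma swap_phit_exps: "prod.swap ` phit_exps n m l = phi_exps m n l"
  by (auto simp: phi_exps_def phit_exps_def image_Un product_swap)

lemma mat_inner_swap:
  assumes "dim_col X = 1" "dim_col Y = 1"
  shows "mat_inner (L \<circ> swap_zw) (map_mat swap_zw X) (map_mat swap_zw Y) = mat_inner L X Y"
  by (rule eq_matI) (use assms in \<open>simp_all add: mat_inner_index inner_zw_swap\<close>)

lemma rev_mat_swap: "rev_mat e (map_mat swap_zw X) = map_mat swap_zw (rev_mat (prod.swap e) X)"
  by (rule eq_matI) (simp_all add: rev_mat_def dagger_swap)

lemma smult_swap: "mon e \<cdot>\<^sub>m map_mat swap_zw X = map_mat swap_zw (mon (prod.swap e) \<cdot>\<^sub>m X)"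
  by (rule eq_matI) simp_all

context positive_functional
begin

lemma positive_functional_swap: "positive_functional (L \<circ> swap_zw) M N"
proof
  fix p assume "lsupp p \<subseteq> box M N" "p \<noteq> 0"
  then have "0 < L (swap_zw p * dagger (swap_zw p))"
    by (intro L_pos) (auto simp: lsupp_swap)
  then show "0 < (L \<circ> swap_zw) (p * dagger p)"
    by (simp add: dagger_swap)
qed (simp_all add: L_add L_const L_dagger swap_const_mult del: swap_mult flip: dagger_swap)

text \<open>The interchanged \<open>phit\<close> satisfies the defining conditions of
  \<open>phi\<close> for the interchanged functional, and uniqueness identifies the two.\<close>

lemma phi_swap:
  assumes "0 \<le> n" "n \<le> M" "m \<le> N" "0 \<le> l" "l \<le> m"
  shows "phi (L \<circ> swap_zw) n m l = swap_zw (phit L m n l)"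
proof -
  show ?thesis
  proof (rule positive_functional.is_orthopoly_unique[OF positive_functional_swap])
    show "phi_exps n m l \<subseteq> box M N" using assms by (auto simp: phi_exps_def)
    show "is_orthopoly (L \<circ> swap_zw) (phi_exps n m l) (n, l) (phi (L \<circ> swap_zw) n m l)"
      using assms by (simp add: positive_functional.is_orthopoly_phi[OF positive_functional_swap])
    show "is_orthopoly (L \<circ> swap_zw) (phi_exps n m l) (n, l) (swap_zw (phit L m n l))"
      using is_orthopoly_swap[OF is_orthopoly_phit[of n m l]] assms by (simp add: swap_phit_exps)
  qed
qed

lemma phit_swap:
  assumes "0 \<le> m" "n \<le> M" "m \<le> N" "0 \<le> l" "l \<le> n"
  shows "phit (L \<circ> swap_zw) n m l = swap_zw (phi L m n l)"
proof -
  show ?thesis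
  proof (rule positive_functional.is_orthopoly_unique[OF positive_functional_swap])
    show "phit_exps n m l \<subseteq> box M N" using assms by (auto simp: phit_exps_def)
    show "is_orthopoly (L \<circ> swap_zw) (phit_exps n m l) (l, m) (phit (L \<circ> swap_zw) n m l)"
      using assms by (simp add: positive_functional.is_orthopoly_phit[OF positive_functional_swap])
    show "is_orthopoly (L \<circ> swap_zw) (phit_exps n m l) (l, m) (swap_zw (phi L m n l))"
      using is_orthopoly_swap[OF is_orthopoly_phi[of m n l]] assms by (simp add: swap_phi_exps)
  qed
qed

lemma Phi_swap: "0 \<le> n \<Longrightarrow> n \<le> M \<Longrightarrow> m \<le> N \<Longrightarrow> Phi (L \<circ> swap_zw) n m = map_mat swap_zw (Phit L m n)"
  by (rule eq_matI) (simp_all add: Phi_index Phit_index phi_swap)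

lemma Phit_swap: "0 \<le> m \<Longrightarrow> n \<le> M \<Longrightarrow> m \<le> N \<Longrightarrow> Phit (L \<circ> swap_zw) n m = map_mat swap_zw (Phi L m n)"
  by (rule eq_matI) (simp_all add: Phi_index Phit_index phit_swap)

text \<open>For entries p of \<open>Phi L n (m - 1)\<close> and q of
  \<open>Phit L (n - 1) m\<close>, both inner products are \<open>L\<close> of
  \<open>mon (1 - n, 1 - m)\<close> times p q. The right-hand side is what \<open>K1mat\<close>
  becomes when z and w are interchanged.\<close>

lemma K1mat_transpose:
  "transpose_mat (K1mat L n m) =
     mat_inner L (mon (1, 0) \<cdot>\<^sub>m Phit L (n - 1) m) (rev_mat (n, m - 1) (Phi L n (m - 1)))"
proof (rule eq_matI)
  fix i j
  let ?B = "mat_inner L (mon (1, 0) \<cdot>\<^sub>m Phit L (n - 1) m) (rev_mat (n, m - 1) (Phi L n (m - 1)))"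
  assume "i < dim_row ?B" "j < dim_col ?B"
  then have ij: "i < nat n" "j < nat m" by simp_all
  have "inner_zw L (mon (0, 1) * p) (mon (n - 1, m) * dagger q) =
      inner_zw L (mon (1, 0) * q) (mon (n, m - 1) * dagger p)" for p q
  proof -
    have "mon (0, 1) * p * dagger (mon (n - 1, m) * dagger q) = (mon (0, 1) * mon (- (n - 1), - m)) * (p * q)"
      "mon (1, 0) * q * dagger (mon (n, m - 1) * dagger p) = (mon (1, 0) * mon (- n, - (m - 1))) * (p * q)"
      by (simp_all add: ac_simps)
    then show ?thesis by (simp add: inner_zw_def mult_single)
  qed
  then show "transpose_mat (K1mat L n m) $$ (i, j) = ?B $$ (i, j)"
    using ij by (simp add: K1mat_def transpose_Phit_rev mat_inner_index rev_mat_def monom_zw_eq)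
qed (simp_all add: K1mat_def transpose_Phit_rev)

lemma K1mat_mult_Gamma_t_mat_inv:
  assumes "1 \<le> n" "n \<le> N" "1 \<le> m" "m \<le> M"
  shows "K1mat L n m * transpose_mat (Gamma_t_mat L (n - 1) m) =
    mat_inv (Amat L n (m - 1)) * K1mat L (n - 1) m
    - mat_inv (Amat L n (m - 1)) * Ehat L n (m - 1) * map_mat cnj (Kmat L (n - 1) m)"
proof -
  let ?s = "L \<circ> swap_zw"
  note s = positive_functional_swap
  let ?G = "Gamma_t_mat L (n - 1) m" and ?K = "Kmat L (n - 1) m"
    and ?A = "Amat L n (m - 1)" and ?E = "Ehat L n (m - 1)"
    and ?K1 = "K1mat L n m" and ?K1' = "K1mat L (n - 1) m"
  let ?B = "mat_inv ?A"
  have G: "Gamma_mat ?s m (n - 1) = ?G"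
    using assms by (simp add: Gamma_mat_def Gamma_t_mat_def Phi_swap mat_inner_swap)
  have A: "Amat_t ?s (m - 1) n = ?A"
    using assms by (simp add: Amat_t_def Amat_def Phit_swap mat_inner_swap monom_zw_eq smult_swap)
  have E: "Ehat_t ?s (m - 1) n = ?E"
    using assms by (simp add: Ehat_t_def Ehat_def Phit_swap mat_inner_swap monom_zw_eq smult_swap
        rev_mat_swap transpose_Phi_rev transpose_Phit_rev)
  \<comment> \<open>The interchange pairs the two columns in the opposite order, and with no
    reversal involved this yields the adjoint, hence the conjugate in the claim.\<close>
  have K: "Kmat ?s m (n - 1) = transpose_mat (map_mat cnj ?K)"
    using assms mat_inner_commute[of "Phi L (n - 1) (m - 1)" "Phit L (n - 1 - 1) m"]
    by (simp add: Kmat_def Phi_swap Phit_swap mat_inner_swap map_mat_transpose)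
  have K1: "K1mat ?s m n = transpose_mat ?K1" "K1mat ?s m (n - 1) = transpose_mat ?K1'"
    using assms unfolding K1mat_transpose
    by (simp_all add: K1mat_def Phi_swap Phit_swap mat_inner_swap monom_zw_eq smult_swap
        rev_mat_swap transpose_Phit_rev)
  have carr: "?G \<in> carrier_mat (nat (n - 1)) (nat n)" "?K \<in> carrier_mat (nat m) (nat (n - 1))"
      "?A \<in> carrier_mat (nat m) (nat m)" "?E \<in> carrier_mat (nat m) (nat m)"
      "?K1 \<in> carrier_mat (nat m) (nat n)" "?K1' \<in> carrier_mat (nat m) (nat (n - 1))"
    by (simp_all add: Gamma_t_mat_def Kmat_def Amat_def Ehat_def K1mat_def transpose_Phit_rev
        transpose_Phi_rev carrier_matI)
  have B: "?B \<in> carrier_mat (nat m) (nat m)"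
    using positive_functional.mat_inv_Amat_t(3)[OF s, of "m - 1" n] assms by (simp add: A)
  have Esym: "transpose_mat ?E = ?E"
    using positive_functional.transpose_Ehat_t[OF s, of "m - 1" n] by (simp add: E)
  have Kc: "map_mat cnj ?K \<in> carrier_mat (nat m) (nat (n - 1))"
    using carr by simp
  have "?G * transpose_mat ?K1 = transpose_mat ?K1' * transpose_mat ?B -
      transpose_mat (map_mat cnj ?K) * ?E * transpose_mat ?B"
    using positive_functional.Gamma_mat_mult_K1mat_inv[OF s, of m n] assms by (simp add: G A E K K1)
  also have "\<dots> = transpose_mat (?B * ?K1') - transpose_mat (?B * (?E * map_mat cnj ?K))"
    using carr B Kc
    by (simp add: transpose_mult[OF B carr(6)] transpose_mult[OF B mult_carrier_mat[OF carr(4) Kc]]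
        transpose_mult[OF carr(4) Kc] Esym)
  also have "?B * (?E * map_mat cnj ?K) = ?B * ?E * map_mat cnj ?K"
    using B carr(4) Kc by (rule assoc_mult_mat[symmetric])
  finally have "transpose_mat (?G * transpose_mat ?K1) =
      transpose_mat (transpose_mat (?B * ?K1') - transpose_mat (?B * ?E * map_mat cnj ?K))"
    by simp
  moreover have "transpose_mat (?G * transpose_mat ?K1) = ?K1 * transpose_mat ?G"
    using transpose_mult[OF carr(1), of "transpose_mat ?K1"] carr by simp
  moreover have "transpose_mat (transpose_mat (?B * ?K1') - transpose_mat (?B * ?E * map_mat cnj ?K)) =
      ?B * ?K1' - ?B * ?E * map_mat cnj ?K"
    by (rule eq_matI) (use carr B in \<open>auto simp del: index_mult_mat(1)\<close>)
  ultimately show ?thesis by simp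
qed

end

theorem lemma3p12:
  fixes L :: "laurent \<Rightarrow> complex" and N M n m :: int
  assumes "pos_def_functional N M L"
    and "0 < n" "n \<le> N" "0 < m" "m \<le> M"
  shows "(Gamma_mat L n (m - 1) * K1mat L n m =
           K1mat L n (m - 1) * transpose_mat (mat_inv (Amat_t L (n - 1) m))
           - Kmat L n (m - 1) * Ehat_t L (n - 1) m * transpose_mat (mat_inv (Amat_t L (n - 1) m)))
    \<and> (K1mat L n m * transpose_mat (Gamma_t_mat L (n - 1) m) =
           mat_inv (Amat L n (m - 1)) * K1mat L (n - 1) m
           - mat_inv (Amat L n (m - 1)) * Ehat L n (m - 1) * map_mat cnj (Kmat L (n - 1) m))"
proof -
  let ?T = "truncated N M L"
  have T: "positive_functional ?T N M"
    using assms(1) by (rule positive_functional_truncated)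
  have lin: "linear_functional N M L"
    using assms(1) by (simp add: pos_def_functional_def)
  note [simp] = Phi_truncated[OF lin] Phit_truncated[OF lin]
  have supp_Phi: "supp_in (Phi L i j) (box i j)" if "0 \<le> i" "i \<le> N" "j \<le> M" for i j
    using positive_functional.supp_in_Phi[OF T, of i j] that by simp
  have supp_Phit: "supp_in (Phit L i j) (box i j)" if "0 \<le> j" "i \<le> N" "j \<le> M" for i j
    using positive_functional.supp_in_Phit[OF T, of j i] that by simp
  have supp_Phi': "supp_in (Phi L i j) (box N M)" if "0 \<le> i" "i \<le> N" "j \<le> M" for i j
    by (rule supp_in_mono[OF supp_Phi]) (use that in auto)
  have supp_Phit': "supp_in (Phit L i j) (box N M)" if "0 \<le> j" "i \<le> N" "j \<le> M" for i j
    by (rule supp_in_mono[OF supp_Phit]) (use that in auto)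
  \<comment> \<open>A shift uses up one degree, hence the strict bound on the shifted variable. The
    coefficients meet it: z multiplies only polynomials of z-degree at most \<open>n - 1\<close>,
    and w only polynomials of w-degree at most \<open>m - 1\<close>.\<close>
  have supp_zPhi: "supp_in (mon (1, 0) \<cdot>\<^sub>m Phi L i j) (box N M)" if "0 \<le> i" "i < N" "j \<le> M" for i j
    by (rule supp_in_smult[OF supp_Phi]) (use that in auto)
  have supp_wPhi: "supp_in (mon (0, 1) \<cdot>\<^sub>m Phi L i j) (box N M)" if "0 \<le> i" "i \<le> N" "j < M" for i j
    by (rule supp_in_smult[OF supp_Phi]) (use that in auto)
  have supp_wPhit: "supp_in (mon (0, 1) \<cdot>\<^sub>m Phit L i j) (box N M)" if "0 \<le> j" "i \<le> N" "j < M" for i j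
    by (rule supp_in_smult[OF supp_Phit]) (use that in auto)
  have supp_rev_Phi: "supp_in (rev_mat (i, j) (Phi L i j)) (box N M)" if "0 \<le> i" "i \<le> N" "j \<le> M" for i j
    by (rule supp_in_rev_mat[OF supp_Phi]) (use that in auto)
  have supp_rev_Phit: "supp_in (rev_mat (i, j) (Phit L i j)) (box N M)" if "0 \<le> j" "i \<le> N" "j \<le> M" for i j
    by (rule supp_in_rev_mat[OF supp_Phit]) (use that in auto)
  note supp = supp_Phi' supp_Phit' supp_zPhi supp_wPhi supp_wPhit supp_rev_Phi supp_rev_Phit
  note eqs = mat_inner_truncated[OF lin] supp transpose_Phi_rev transpose_Phit_rev monom_zw_eq
  have "Gamma_mat ?T n (m - 1) = Gamma_mat L n (m - 1)" "Gamma_t_mat ?T (n - 1) m = Gamma_t_mat L (n - 1) m"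
    "K1mat ?T n m = K1mat L n m" "K1mat ?T n (m - 1) = K1mat L n (m - 1)" "K1mat ?T (n - 1) m = K1mat L (n - 1) m"
    "Kmat ?T n (m - 1) = Kmat L n (m - 1)" "Kmat ?T (n - 1) m = Kmat L (n - 1) m"
    "Amat_t ?T (n - 1) m = Amat_t L (n - 1) m" "Amat ?T n (m - 1) = Amat L n (m - 1)"
    "Ehat_t ?T (n - 1) m = Ehat_t L (n - 1) m" "Ehat ?T n (m - 1) = Ehat L n (m - 1)"
    using assms unfolding Gamma_mat_def Gamma_t_mat_def K1mat_def Kmat_def Amat_t_def Amat_def Ehat_t_def Ehat_def
    by (simp_all add: eqs)
  then show ?thesis
    using positive_functional.Gamma_mat_mult_K1mat_inv[OF T, of n m]
      positive_functional.K1mat_mult_Gamma_t_mat_inv[OF T, of n m] assms by simp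
qed

thm_deps lemma3p12

end
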